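(* Let $q(x) \in \mathbb{Z}[i][x]$ be an intersective polynomial of degree $d \geq 2$ and let $N \geq 3$ be an integer. Suppose $A$ is a nonempty subset of $[N]$ such that $A$ does not contain two distinct elements whose difference equals $q(z)$ for some Gaussian integer $z$. Then \[ \frac{|A|}{N^2} \ll_q \frac{1}{(\log\log N)^{\varepsilon}}, \] where $\varepsilon>0$ is a constant depending only on $d$, and the implied constant depends only on $q$.
   Context: For a real number $X \geq 1$, $[X] := \{a+bi \in \mathbb{Z}[i] : a,b \in \mathbb{Z},\ 1 \le a,b \le X\}$; in particular $[N]$ has $N^2$ elements. A polynomial $h(x) \in \mathbb{Z}[i][x]$ is called intersective if for every nonzero Gaussian integer $\alpha$ there exists a Gaussian integer $z$ such that $\alpha$ divides $h(z)$ in $\mathbb{Z}[i]$. *)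

theory Defs
  imports Complex_Main "HOL-Computational_Algebra.Polynomial"
begin

definition gauss_int :: "complex \<Rightarrow> bool" where
  "gauss_int z \<longleftrightarrow> Re z \<in> \<int> \<and> Im z \<in> \<int>"

definition gdvd :: "complex \<Rightarrow> complex \<Rightarrow> bool" where
  "gdvd \<alpha> \<beta> \<longleftrightarrow> (\<exists>\<gamma>. gauss_int \<gamma> \<and> \<beta> = \<alpha> * \<gamma>)"

definition gauss_poly :: "complex poly \<Rightarrow> bool" where
  "gauss_poly q \<longleftrightarrow> (\<forall>i. gauss_int (coeff q i))"

definition intersective :: "complex poly \<Rightarrow> bool" where
  "intersective h \<longleftrightarrow>
     (\<forall>\<alpha>. gauss_int \<alpha> \<and> \<alpha> \<noteq> 0 \<longrightarrow> (\<exists>z. gauss_int z \<and> gdvd \<alpha> (poly h z)))"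

definition gbox :: "real \<Rightarrow> complex set" where
  "gbox X = {Complex (of_int a) (of_int b) | a b. 1 \<le> a \<and> real_of_int a \<le> X \<and> 1 \<le> b \<and> real_of_int b \<le> X}"

end

theory Submission
  imports Defs "HOL-Analysis.Convex"
begin

text \<open>
  Density increment by van der Corput differencing. Suppose \<open>A\<close> has density \<open>\<rho> \<ge> \<delta>\<close> on
  \<open>x\<^sub>0 + D [L]\<close>. Intersectivity gives \<open>r\<close> with \<open>D\<close> dividing \<open>q(r)\<close>, so
  \<open>p(w) = q(r + D w) / D\<close> maps Gaussian integers to Gaussian integers, and the rescaled set has no
  nonzero difference \<open>p(w)\<close>. Hence its balanced function \<open>g\<close> correlates along the values of \<open>p\<close>.
  With \<open>w = y\<^sub>1 + \<dots> + y\<^sub>j + z\<close>, where \<open>d = j + 1\<close>, the \<open>y\<^sub>i\<close> run over a set of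
  size polynomial in \<open>1 / \<delta>\<close> and in \<open>D\<close>, and \<open>z\<close> runs over \<open>[M]\<close>, each of \<open>j\<close> applications of
  Cauchy--Schwarz replaces \<open>p\<close> by a difference \<open>p(y' + \<cdot>) - p(y + \<cdot>)\<close> and lowers its degree by one.
  The resulting linear polynomial has a small slope \<open>E\<close>, and \<open>g\<close> has large mean square over the
  translates of \<open>E [M]\<close>; so \<open>A\<close> has density at least \<open>\<rho> + c \<delta>\<^bsup>2^(d+1)\<^esup>\<close> on some
  \<open>x' + D E [M]\<close>. A fresh \<open>r\<close> is chosen for the modulus \<open>D E\<close>, so no compatible system of
  roots of \<open>q\<close> is needed. Each step replaces \<open>L\<close> by a fixed power of itself and there are at
  most \<open>O(\<delta>\<^bsup>-2^(d+1)\<^esup>)\<close> steps, which is what costs two logarithms.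
\<close>

section \<open>Gaussian integers and boxes\<close>

lemma gauss_int_add: "gauss_int a \<Longrightarrow> gauss_int b \<Longrightarrow> gauss_int (a + b)"
  and gauss_int_mult: "gauss_int a \<Longrightarrow> gauss_int b \<Longrightarrow> gauss_int (a * b)"
  by (auto simp: gauss_int_def)

lemma gauss_int_of_int: "gauss_int (of_int k)"
  and gauss_int_of_nat: "gauss_int (of_nat n)"
  and gauss_int_Complex: "gauss_int (Complex (of_int k) (of_int l))"
  by (auto simp: gauss_int_def)

lemma gauss_int_1: "gauss_int 1"
  using gauss_int_of_nat[of 1] by simp

lemma gauss_int_power: "gauss_int a \<Longrightarrow> gauss_int (a ^ n)"
  by (induction n) (auto intro: gauss_int_mult gauss_int_1)

lemma gauss_int_sum_list: "(\<And>x. x \<in> set xs \<Longrightarrow> gauss_int x) \<Longrightarrow> gauss_int (sum_list xs)"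
  by (induction xs) (auto intro: gauss_int_add simp: gauss_int_def)

lemma gauss_int_obtain:
  assumes "gauss_int z"
  obtains k l :: int where "z = Complex (of_int k) (of_int l)"
  using assms by (metis Ints_cases complex_surj gauss_int_def)

lemma gauss_poly_pCons: "gauss_poly (pCons a p) \<longleftrightarrow> gauss_int a \<and> gauss_poly p"
proof
  assume *: "gauss_poly (pCons a p)"
  show "gauss_int a \<and> gauss_poly p"
    unfolding gauss_poly_def
    using * coeff_pCons_0[of a p] coeff_pCons_Suc[of a p] unfolding gauss_poly_def by metis
next
  assume "gauss_int a \<and> gauss_poly p"
  then show "gauss_poly (pCons a p)"
    by (auto simp: gauss_poly_def coeff_pCons split: nat.split)
qed

lemma gauss_int_poly: "gauss_poly p \<Longrightarrow> gauss_int z \<Longrightarrow> gauss_int (poly p z)"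
proof (induction p)
  case 0
  then show ?case by (simp add: gauss_int_def)
next
  case (pCons a p)
  then show ?case by (auto simp: gauss_poly_pCons intro!: gauss_int_add gauss_int_mult)
qed

section \<open>Roots of \<open>q\<close> modulo a Gaussian integer\<close>

lemma poly_shift_cong:
  assumes "gauss_poly p" "gauss_int z" "gauss_int D" "gauss_int w"
  shows "\<exists>v. gauss_int v \<and> poly p (z + D * w) = poly p z + D * v"
  using assms(1)
proof (induction p)
  case 0
  then show ?case using gauss_int_of_nat[of 0] by (auto intro!: exI[of _ 0])
next
  case (pCons a p)
  then obtain v where v: "gauss_int v" "poly p (z + D * w) = poly p z + D * v"
    by (auto simp: gauss_poly_pCons)
  have "gauss_int (z * v + w * (poly p z + D * v))"
    using assms v pCons.prems
    by (intro gauss_int_add gauss_int_mult gauss_int_poly) (auto simp: gauss_poly_pCons)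
  moreover have "poly (pCons a p) (z + D * w) = poly (pCons a p) z + D * (z * v + w * (poly p z + D * v))"
    by (simp add: v algebra_simps)
  ultimately show ?case by blast
qed

text \<open>Rounding both coordinates of \<open>z / D\<close> leaves a remainder with coordinates at
  most 1/2, hence of modulus at most 1. This makes the later size bounds independent of which root
  modulo \<open>D\<close> intersectivity supplies.\<close>

lemma gauss_int_residue:
  assumes "gauss_int z" "gauss_int D" "D \<noteq> 0"
  obtains w where "gauss_int w" "cmod (z + D * w) \<le> cmod D"
proof -
  define t where "t = z / D"
  define w where "w = - Complex (of_int (round (Re t))) (of_int (round (Im t)))"
  have w: "gauss_int w"
    unfolding w_def gauss_int_def by auto
  have "\<bar>Re (t + w)\<bar> \<le> 1/2" "\<bar>Im (t + w)\<bar> \<le> 1/2"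
    using of_int_round_abs_le[of "Re t"] of_int_round_abs_le[of "Im t"]
    by (auto simp: w_def abs_minus_commute)
  then have "cmod (t + w) \<le> 1"
    using cmod_le[of "t + w"] by linarith
  moreover have "z + D * w = D * (t + w)"
    using assms by (simp add: t_def field_simps)
  ultimately have "cmod (z + D * w) \<le> cmod D"
    by (simp add: norm_mult mult_left_le)
  with w show thesis by (rule that)
qed

text \<open>Moving inside a residue class modulo \<open>D\<close> changes \<open>q\<close> by
  multiples of \<open>D\<close>. So one root modulo \<open>D\<close> yields a small representative
  \<open>r\<close>, and each value \<open>q (r + D * w)\<close> is divisible by
  \<open>D\<close>.\<close>

lemma intersective_root_mod:
  assumes "gauss_poly q" "intersective q" "gauss_int D" "D \<noteq> 0"
  obtains r where "gauss_int r" "cmod r \<le> cmod D"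
    "\<And>w. gauss_int w \<Longrightarrow> gauss_int (poly q (r + D * w) / D)"
proof -
  obtain z where z: "gauss_int z" "gdvd D (poly q z)"
    using assms by (auto simp: intersective_def)
  then obtain u where u: "gauss_int u" "poly q z = D * u"
    by (auto simp: gdvd_def)
  obtain w0 where w0: "gauss_int w0" "cmod (z + D * w0) \<le> cmod D"
    using gauss_int_residue z assms by metis
  have "gauss_int (poly q (z + D * w0 + D * w) / D)" if w: "gauss_int w" for w
  proof -
    obtain v where "gauss_int v" "poly q (z + D * (w0 + w)) = poly q z + D * v"
      using poly_shift_cong[OF assms(1) z(1) assms(3) gauss_int_add[OF w0(1) w]] by blast
    then have "poly q (z + D * w0 + D * w) / D = u + v"
      using u assms by (simp add: field_simps)
    then show ?thesis using u \<open>gauss_int v\<close> gauss_int_add by simp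
  qed
  with w0 z assms show thesis
    by (intro that[of "z + D * w0"] gauss_int_add gauss_int_mult)
qed

section \<open>Counting points of boxes and of their translates\<close>

lemma gbox_of_nat_eq:
  "gbox (real n) = (\<lambda>(a, b). Complex (of_int a) (of_int b)) ` ({1..int n} \<times> {1..int n})"
  by (force simp: gbox_def)

lemma inj_on_Complex_of_int: "inj_on (\<lambda>(a, b). Complex (of_int a) (of_int b)) S"
  by (auto simp: inj_on_def)

lemma finite_gbox: "finite (gbox (real n))"
  by (simp add: gbox_of_nat_eq)

lemma card_gbox: "card (gbox (real n)) = n ^ 2"
  by (simp add: gbox_of_nat_eq card_image inj_on_Complex_of_int card_cartesian_product power2_eq_square)

lemma Complex_in_gbox:
  "Complex (of_int a) (of_int b) \<in> gbox (real n) \<longleftrightarrow> a \<in> {1..int n} \<and> b \<in> {1..int n}"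
  by (force simp: gbox_def)

lemma gbox_gauss_int: "z \<in> gbox X \<Longrightarrow> gauss_int z"
  by (auto simp: gbox_def gauss_int_Complex)

lemma gbox_cmod_le:
  assumes "z \<in> gbox (real n)"
  shows "cmod z \<le> 2 * real n"
proof -
  obtain a b where "z = Complex (of_int a) (of_int b)" "a \<in> {1..int n}" "b \<in> {1..int n}"
    using assms by (auto simp: gbox_of_nat_eq)
  then show ?thesis using cmod_le[of z] by simp
qed

lemma card_interval_shift_out: "card {a \<in> {1..int n}. a + k \<notin> {1..int n}} \<le> nat \<bar>k\<bar>"
proof (cases "k \<ge> 0")
  case True
  have "{a \<in> {1..int n}. a + k \<notin> {1..int n}} \<subseteq> {int n - k<..int n}" using True by auto
  then have "card {a \<in> {1..int n}. a + k \<notin> {1..int n}} \<le> card {int n - k<..int n}"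
    by (intro card_mono) auto
  then show ?thesis using True by simp
next
  case False
  have "{a \<in> {1..int n}. a + k \<notin> {1..int n}} \<subseteq> {1..-k}" using False by auto
  then have "card {a \<in> {1..int n}. a + k \<notin> {1..int n}} \<le> card {1..-k}"
    by (intro card_mono) auto
  then show ?thesis using False by simp
qed

text \<open>A shifted point can leave the box only through one of its two coordinates, so the
  exceptions lie in two strips of widths \<open>\<bar>Re u\<bar>\<close> and
  \<open>\<bar>Im u\<bar>\<close>, each at most \<open>R\<close>.\<close>

lemma card_gbox_shift_out:
  assumes "gauss_int u" "cmod u \<le> R"
  shows "real (card {x \<in> gbox (real n). x + u \<notin> gbox (real n)}) \<le> 2 * real n * R"
proof -
  obtain k l where u: "u = Complex (of_int k) (of_int l)"
    using gauss_int_obtain assms by metis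
  let ?S = "\<lambda>k. {a \<in> {1..int n}. a + k \<notin> {1..int n}}"
  let ?c = "\<lambda>(a, b). Complex (of_int a) (of_int b)"
  have "{x \<in> gbox (real n). x + u \<notin> gbox (real n)} \<subseteq>
          ?c ` (?S k \<times> {1..int n} \<union> {1..int n} \<times> ?S l)"
  proof
    fix x assume x: "x \<in> {x \<in> gbox (real n). x + u \<notin> gbox (real n)}"
    then obtain a b where ab: "x = Complex (of_int a) (of_int b)" "a \<in> {1..int n}" "b \<in> {1..int n}"
      by (auto simp: gbox_of_nat_eq)
    have "x + u = Complex (of_int (a + k)) (of_int (b + l))"
      by (simp add: ab u complex_eq_iff)
    then have "(a, b) \<in> ?S k \<times> {1..int n} \<union> {1..int n} \<times> ?S l"
      using x ab Complex_in_gbox[of "a + k" "b + l" n] by auto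
    then show "x \<in> ?c ` (?S k \<times> {1..int n} \<union> {1..int n} \<times> ?S l)"
      using ab(1) by (intro image_eqI[of _ _ "(a, b)"]) auto
  qed
  moreover have fin: "finite (?S k \<times> {1..int n} \<union> {1..int n} \<times> ?S l)"
    by (rule finite_subset[of _ "{1..int n} \<times> {1..int n}"]) auto
  ultimately have "card {x \<in> gbox (real n). x + u \<notin> gbox (real n)} \<le>
      card (?c ` (?S k \<times> {1..int n} \<union> {1..int n} \<times> ?S l))"
    by (intro card_mono finite_imageI)
  also have "\<dots> \<le> card (?S k \<times> {1..int n} \<union> {1..int n} \<times> ?S l)"
    by (intro card_image_le fin)
  also have "\<dots> \<le> card (?S k \<times> {1..int n}) + card ({1..int n} \<times> ?S l)"
    by (rule card_Un_le)
  also have "\<dots> \<le> nat \<bar>k\<bar> * n + n * nat \<bar>l\<bar>"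
    using card_interval_shift_out[of n k] card_interval_shift_out[of n l]
    unfolding card_cartesian_product by (intro add_mono mult_mono) auto
  finally have "real (card {x \<in> gbox (real n). x + u \<notin> gbox (real n)}) \<le> real (nat \<bar>k\<bar> * n + n * nat \<bar>l\<bar>)"
    by (simp only: of_nat_le_iff)
  also have "\<dots> = real n * (\<bar>Re u\<bar> + \<bar>Im u\<bar>)"
    by (simp add: u algebra_simps)
  also have "\<dots> \<le> real n * (R + R)"
    using abs_Re_le_cmod[of u] abs_Im_le_cmod[of u] assms(2)
    by (intro mult_left_mono add_mono) linarith+
  finally show ?thesis by simp
qed

text \<open>All such \<open>u\<close> lie in the square enlarged by \<open>R\<close> on every side.
  When \<open>R\<close> is small against \<open>n\<close>, passing to this neighbourhood barely
  changes the number of points.\<close>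

lemma card_gbox_neighbourhood:
  assumes "\<And>z. z \<in> Z \<Longrightarrow> gauss_int (E * z) \<and> cmod (E * z) \<le> real R"
  shows "finite {u. \<exists>z\<in>Z. u + E * z \<in> gbox (real n)}"
    and "card {u. \<exists>z\<in>Z. u + E * z \<in> gbox (real n)} \<le> (n + 2 * R) ^ 2"
proof -
  let ?c = "\<lambda>(a, b). Complex (of_int a) (of_int b)"
  let ?I = "{1 - int R..int n + int R}"
  have sub: "{u. \<exists>z\<in>Z. u + E * z \<in> gbox (real n)} \<subseteq> ?c ` (?I \<times> ?I)"
  proof
    fix u assume "u \<in> {u. \<exists>z\<in>Z. u + E * z \<in> gbox (real n)}"
    then obtain z where z: "z \<in> Z" "u + E * z \<in> gbox (real n)" by blast
    obtain k l where kl: "E * z = Complex (of_int k) (of_int l)"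
      using gauss_int_obtain assms z by metis
    obtain a b where ab: "u + E * z = Complex (of_int a) (of_int b)" "a \<in> {1..int n}" "b \<in> {1..int n}"
      using z by (auto simp: gbox_of_nat_eq)
    have "\<bar>real_of_int k\<bar> \<le> real R" "\<bar>real_of_int l\<bar> \<le> real R"
      using abs_Re_le_cmod[of "E * z"] abs_Im_le_cmod[of "E * z"] assms[OF z(1)]
      by (simp_all only: kl complex.sel) linarith+
    then have "\<bar>k\<bar> \<le> int R" "\<bar>l\<bar> \<le> int R" by linarith+
    moreover have "u = Complex (of_int (a - k)) (of_int (b - l))"
    proof -
      have "u = Complex (of_int a) (of_int b) - Complex (of_int k) (of_int l)"
        using ab(1) kl by (metis add_diff_cancel_right')
      then show ?thesis by (simp add: complex_eq_iff)
    qed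
    ultimately show "u \<in> ?c ` (?I \<times> ?I)"
      using ab by (intro image_eqI[of _ _ "(a - k, b - l)"]) auto
  qed
  show "finite {u. \<exists>z\<in>Z. u + E * z \<in> gbox (real n)}"
    by (rule finite_subset[OF sub]) auto
  have "card {u. \<exists>z\<in>Z. u + E * z \<in> gbox (real n)} \<le> card (?c ` (?I \<times> ?I))"
    by (intro card_mono sub) auto
  also have "\<dots> \<le> card (?I \<times> ?I)"
    by (intro card_image_le) auto
  also have "\<dots> = (n + 2 * R) ^ 2"
    by (simp add: card_cartesian_product power2_eq_square nat_add_distrib nat_mult_distrib add.commute)
  finally show "card {u. \<exists>z\<in>Z. u + E * z \<in> gbox (real n)} \<le> (n + 2 * R) ^ 2" .
qed

section \<open>Van der Corput differencing\<close>

text \<open>The substitution \<open>u = x + a\<close> is exact, because \<open>\<Omega>\<close>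
  contains the whole translate of \<open>\<Lambda>\<close> and \<open>g\<close> vanishes off
  \<open>\<Lambda>\<close>.\<close>

lemma sum_shift_support:
  fixes g h :: "'a::ab_group_add \<Rightarrow> real"
  assumes "finite \<Omega>" "\<And>x. x \<notin> \<Lambda> \<Longrightarrow> g x = 0" "(\<lambda>u. u - a) ` \<Lambda> \<subseteq> \<Omega>"
  shows "(\<Sum>x\<in>\<Omega>. g (x + a) * h x) = (\<Sum>u\<in>\<Lambda>. g u * h (u - a))"
proof -
  have "(\<Sum>x\<in>\<Omega>. g (x + a) * h x) = (\<Sum>x\<in>(\<lambda>u. u - a) ` \<Lambda>. g (x + a) * h x)"
  proof (rule sum.mono_neutral_right[OF assms(1,3)], rule ballI)
    fix x assume x: "x \<in> \<Omega> - (\<lambda>u. u - a) ` \<Lambda>"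
    have "x + a \<notin> \<Lambda>"
    proof
      assume "x + a \<in> \<Lambda>"
      then have "x + a - a \<in> (\<lambda>u. u - a) ` \<Lambda>" by (rule imageI)
      with x show False by simp
    qed
    then show "g (x + a) * h x = 0" by (simp add: assms)
  qed
  also have "\<dots> = (\<Sum>u\<in>\<Lambda>. g u * h (u - a))"
    by (subst sum.reindex) (auto simp: inj_on_def)
  finally show ?thesis .
qed

text \<open>The range of summation is a product \<open>V \<times> Y\<close> and Cauchy--Schwarz leaves the
  sum over \<open>Y\<close> inside the square: unlike the usual shift \<open>h\<close> of a single interval,
  this produces no boundary terms.\<close>

lemma van_der_Corput_step:
  fixes F g :: "'a::ab_group_add \<Rightarrow> real" and P :: "'v \<Rightarrow> 'y \<Rightarrow> 'a"
  assumes fin: "finite \<Lambda>" "finite V" "finite Y" and V: "V \<noteq> {}"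
    and supp: "\<And>x. x \<notin> \<Lambda> \<Longrightarrow> g x = 0"
    and g2: "(\<Sum>x\<in>\<Lambda>. (g x)\<^sup>2) \<le> G" and F2: "(\<Sum>x\<in>\<Lambda>. (F x)\<^sup>2) \<le> G"
    and G: "G > 0" and eta: "\<eta> > 0" and Y: "2 \<le> \<eta>\<^sup>2 * real (card Y)"
    and big: "\<eta> * real (card V) * real (card Y) * G \<le> \<bar>\<Sum>v\<in>V. \<Sum>y\<in>Y. \<Sum>x\<in>\<Lambda>. F x * g (x + P v y)\<bar>"
  shows "\<exists>y\<in>Y. \<exists>y'\<in>Y. y \<noteq> y' \<and>
    \<eta>\<^sup>2 / 2 * real (card V) * G \<le> \<bar>\<Sum>v\<in>V. \<Sum>x\<in>\<Lambda>. g x * g (x + (P v y' - P v y))\<bar>"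
proof (rule ccontr)
  assume "\<not> ?thesis"
  then have small: "\<bar>\<Sum>v\<in>V. \<Sum>x\<in>\<Lambda>. g x * g (x + (P v y' - P v y))\<bar> < \<eta>\<^sup>2 / 2 * real (card V) * G"
    if "y \<in> Y" "y' \<in> Y" "y \<noteq> y'" for y y'
    using that by force
  define n where "n = real (card Y)"
  define k where "k = real (card V)"
  have n: "n > 0"
    using Y eta unfolding n_def by (cases "card Y = 0") auto
  have k: "k > 0" using V fin by (simp add: k_def card_gt_0_iff)
  \<comment> \<open>Large enough for every translate on which some \<open>g (x + P v y)\<close> can
    be nonzero; each shift by \<open>P v y\<close> then turns a sum over \<open>\<Omega>\<close>
    into a full sum over \<open>\<Lambda>\<close>.\<close>
  define \<Omega> where "\<Omega> = \<Lambda> \<union> (\<Union>v\<in>V. \<Union>y\<in>Y. (\<lambda>u. u - P v y) ` \<Lambda>)"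
  have fOmega: "finite \<Omega>" using fin by (simp add: \<Omega>_def)
  define S where "S = (\<Sum>v\<in>V. \<Sum>y\<in>Y. \<Sum>x\<in>\<Lambda>. F x * g (x + P v y))"
  define W where "W = (\<Sum>v\<in>V. \<Sum>x\<in>\<Omega>. (\<Sum>y\<in>Y. g (x + P v y))\<^sup>2)"
  have "S = (\<Sum>v\<in>V. \<Sum>x\<in>\<Lambda>. F x * (\<Sum>y\<in>Y. g (x + P v y)))"
    unfolding S_def by (rule sum.cong[OF refl], subst sum.swap) (simp add: sum_distrib_left)
  also have "\<dots> = (\<Sum>i\<in>V \<times> \<Lambda>. F (snd i) * (\<Sum>y\<in>Y. g (snd i + P (fst i) y)))"
    by (simp add: sum.cartesian_product split_beta)
  finally have "S\<^sup>2 \<le> (\<Sum>i\<in>V \<times> \<Lambda>. (F (snd i))\<^sup>2) * (\<Sum>i\<in>V \<times> \<Lambda>. (\<Sum>y\<in>Y. g (snd i + P (fst i) y))\<^sup>2)"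
    by (simp only: Cauchy_Schwarz_ineq_sum)
  also have "(\<Sum>i\<in>V \<times> \<Lambda>. (F (snd i))\<^sup>2) = k * (\<Sum>x\<in>\<Lambda>. (F x)\<^sup>2)"
    using sum.cartesian_product[of "\<lambda>v x. (F x)\<^sup>2" \<Lambda> V] by (simp add: split_beta k_def)
  also have "(\<Sum>i\<in>V \<times> \<Lambda>. (\<Sum>y\<in>Y. g (snd i + P (fst i) y))\<^sup>2) = (\<Sum>v\<in>V. \<Sum>x\<in>\<Lambda>. (\<Sum>y\<in>Y. g (x + P v y))\<^sup>2)"
    by (simp add: sum.cartesian_product split_beta)
  also have "k * (\<Sum>x\<in>\<Lambda>. (F x)\<^sup>2) * (\<Sum>v\<in>V. \<Sum>x\<in>\<Lambda>. (\<Sum>y\<in>Y. g (x + P v y))\<^sup>2) \<le> k * G * W"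
    unfolding W_def
    by (intro mult_mono F2 sum_mono sum_mono2 fOmega)
      (use k F2 G in \<open>auto simp: \<Omega>_def intro!: sum_nonneg\<close>)
  finally have S2: "S\<^sup>2 \<le> k * G * W" .
  \<comment> \<open>Expanding the square gives pairs \<open>y\<close>, \<open>y'\<close>;
    substituting \<open>u = x + P v y\<close> leaves only the difference
    \<open>P v y' - P v y\<close>.\<close>
  have W_eq: "W = (\<Sum>y\<in>Y. \<Sum>y'\<in>Y. \<Sum>v\<in>V. \<Sum>x\<in>\<Lambda>. g x * g (x + (P v y' - P v y)))"
  proof -
    have "W = (\<Sum>v\<in>V. \<Sum>y\<in>Y. \<Sum>y'\<in>Y. \<Sum>x\<in>\<Omega>. g (x + P v y) * g (x + P v y'))"
      unfolding W_def power2_eq_square sum_product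
      by (rule sum.cong[OF refl], rule trans[OF sum.swap], rule sum.cong[OF refl], rule sum.swap)
    also have "\<dots> = (\<Sum>v\<in>V. \<Sum>y\<in>Y. \<Sum>y'\<in>Y. \<Sum>x\<in>\<Lambda>. g x * g (x + (P v y' - P v y)))"
    proof (intro sum.cong[OF refl])
      fix v y y' assume vy: "v \<in> V" "y \<in> Y" "y' \<in> Y"
      have "(\<Sum>x\<in>\<Omega>. g (x + P v y) * g (x + P v y')) = (\<Sum>u\<in>\<Lambda>. g u * g (u - P v y + P v y'))"
        using vy by (intro sum_shift_support fOmega supp) (auto simp: \<Omega>_def)
      then show "(\<Sum>x\<in>\<Omega>. g (x + P v y) * g (x + P v y')) = (\<Sum>x\<in>\<Lambda>. g x * g (x + (P v y' - P v y)))"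
        by (simp add: algebra_simps)
    qed
    also have "\<dots> = (\<Sum>y\<in>Y. \<Sum>v\<in>V. \<Sum>y'\<in>Y. \<Sum>x\<in>\<Lambda>. g x * g (x + (P v y' - P v y)))"
      by (rule sum.swap)
    also have "\<dots> = (\<Sum>y\<in>Y. \<Sum>y'\<in>Y. \<Sum>v\<in>V. \<Sum>x\<in>\<Lambda>. g x * g (x + (P v y' - P v y)))"
      by (rule sum.cong[OF refl], rule sum.swap)
    finally show ?thesis .
  qed
  define e where "e = \<eta>\<^sup>2 / 2 * k * G"
  have e: "e > 0" using eta k G by (simp add: e_def)
  \<comment> \<open>Diagonal pairs contribute at most \<open>k * G\<close> each, all other pairs at
    most \<open>e\<close> by the negated claim. The conditional term is the excess of the diagonal
    over \<open>e\<close>.\<close>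
  have "W \<le> (\<Sum>y\<in>Y. \<Sum>y'\<in>Y. (if y' = y then k * G - e else 0) + e)"
    unfolding W_eq
  proof (intro sum_mono)
    fix y y' assume "y \<in> Y" "y' \<in> Y"
    show "(\<Sum>v\<in>V. \<Sum>x\<in>\<Lambda>. g x * g (x + (P v y' - P v y))) \<le> (if y' = y then k * G - e else 0) + e"
    proof (cases "y' = y")
      case True
      have "(\<Sum>v\<in>V. \<Sum>x\<in>\<Lambda>. g x * g x) \<le> k * G"
        using g2 k by (simp add: k_def power2_eq_square)
      then show ?thesis using True by simp
    next
      case False
      then show ?thesis using small[of y y'] \<open>y \<in> Y\<close> \<open>y' \<in> Y\<close> by (simp add: e_def k_def)
    qed
  qed
  also have "\<dots> = n * (k * G - e) + n * n * e"
    using fin by (simp add: sum.distrib n_def algebra_simps)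
  also have "\<dots> < n * (k * G) + n * n * e"
    using n e by (simp add: algebra_simps)
  \<comment> \<open>The hypothesis \<open>2 \<le> \<eta>\<^sup>2 * real (card Y)\<close> says
    exactly that the diagonal does not outweigh the bound for the off-diagonal pairs.\<close>
  also have "n * (k * G) \<le> n * n * e"
  proof -
    have "1 \<le> n * (\<eta>\<^sup>2 / 2)" using Y by (simp add: n_def mult.commute)
    then have "n * k * G * 1 \<le> n * k * G * (n * (\<eta>\<^sup>2 / 2))"
      using n k G by (intro mult_left_mono) auto
    then show ?thesis by (simp add: e_def algebra_simps)
  qed
  finally have "W < 2 * (n * n * e)" by linarith
  then have "k * G * W < k * G * (2 * (n * n * e))"
    using k G by (intro mult_strict_left_mono) auto
  also have "\<dots> = (\<eta> * k * n * G)\<^sup>2"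
    by (simp add: e_def power2_eq_square)
  also have "\<dots> \<le> S\<^sup>2"
    using power_mono[OF big, of 2] eta k n G by (simp add: S_def k_def n_def)
  finally show False using S2 by simp
qed

section \<open>Differences of polynomials and descent to degree one\<close>

lemma coeff_pcompose_shift:
  fixes p :: "'a::comm_ring_1 poly"
  assumes "degree p \<le> Suc n"
  shows "coeff (p \<circ>\<^sub>p [:y, 1:]) (Suc n) = coeff p (Suc n)
    \<and> coeff (p \<circ>\<^sub>p [:y, 1:]) n = coeff p n + of_nat (Suc n) * y * coeff p (Suc n)"
  using assms
proof (induction n arbitrary: p)
  case 0
  obtain a q where p: "p = pCons a q" by (cases p)
  with 0 have "degree q = 0" by (auto split: if_splits)
  then obtain b where "q = [:b:]" by (rule degree_eq_zeroE)
  then show ?case by (simp add: p pcompose_pCons)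
next
  case (Suc n)
  obtain a q where p: "p = pCons a q" by (cases p)
  with Suc have q: "degree q \<le> Suc n" by (auto split: if_splits)
  have "degree (q \<circ>\<^sub>p [:y, 1:]) \<le> Suc n"
    using degree_pcompose_le[of q "[:y, 1:]"] q by simp
  then have "coeff (q \<circ>\<^sub>p [:y, 1:]) (Suc (Suc n)) = 0" "coeff q (Suc (Suc n)) = 0"
    using q by (auto intro: coeff_eq_0)
  then show ?case
    using Suc.IH[OF q] by (auto simp: p pcompose_pCons algebra_simps coeff_pCons split: nat.split)
qed

text \<open>The leading terms cancel, and the next coefficient is computed exactly: after repeated
  differencing the slope of the linear polynomial must be known to be nonzero and bounded.\<close>

lemma difference_poly:
  fixes p :: "'a::comm_ring_1 poly" and y y' :: 'a
  assumes "degree p \<le> Suc n"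
  defines "r \<equiv> p \<circ>\<^sub>p [:y', 1:] - p \<circ>\<^sub>p [:y, 1:]"
  shows "degree r \<le> n" "coeff r n = of_nat (Suc n) * coeff p (Suc n) * (y' - y)"
    "poly r x = poly p (y' + x) - poly p (y + x)"
proof -
  have "degree (p \<circ>\<^sub>p [:t, 1:]) \<le> Suc n" for t
    using degree_pcompose_le[of p "[:t, 1:]"] assms by simp
  then have "degree r \<le> Suc n"
    unfolding r_def by (intro degree_diff_le)
  moreover have "coeff r (Suc n) = 0"
    using coeff_pcompose_shift[OF assms(1)] by (simp add: r_def)
  ultimately show "degree r \<le> n"
    by (intro degree_le allI impI) (metis Suc_lessI coeff_eq_0 le_less_trans)
  show "coeff r n = of_nat (Suc n) * coeff p (Suc n) * (y' - y)"
    using coeff_pcompose_shift[OF assms(1)] by (simp add: r_def algebra_simps)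
  show "poly r x = poly p (y' + x) - poly p (y + x)"
    by (simp add: r_def poly_pcompose add.commute)
qed

text \<open>The tuple of differencing variables is a list, so that its length can vary in the
  induction; this peels off the variable differenced next.\<close>

lemma sum_lists_length_Suc:
  fixes f :: "'a list \<Rightarrow> 'b::comm_monoid_add"
  shows "(\<Sum>xs | set xs \<subseteq> Y \<and> length xs = Suc j. f xs) =
    (\<Sum>y\<in>Y. \<Sum>xs | set xs \<subseteq> Y \<and> length xs = j. f (y # xs))"
proof -
  have "{xs. set xs \<subseteq> Y \<and> length xs = Suc j} = (\<lambda>(xs, n). n # xs) ` ({xs. set xs \<subseteq> Y \<and> length xs = j} \<times> Y)"
    by (rule lists_length_Suc_eq)
  also have "(\<Sum>xs\<in>\<dots>. f xs) = (\<Sum>(xs, y)\<in>{xs. set xs \<subseteq> Y \<and> length xs = j} \<times> Y. f (y # xs))"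
    by (subst sum.reindex) (auto simp: inj_on_def split_beta)
  also have "\<dots> = (\<Sum>y\<in>Y. \<Sum>xs | set xs \<subseteq> Y \<and> length xs = j. f (y # xs))"
    by (subst sum.cartesian_product[symmetric], rule sum.swap)
  finally show ?thesis .
qed

text \<open>Each differencing step, applied with \<open>\<eta> = 2 * \<sigma>\<close>, turns the
  constant \<open>2 * \<sigma>\<close> into
  \<open>(2 * \<sigma>)\<^sup>2 / 2 = 2 * \<sigma>\<^sup>2\<close>, so the hypothesis reproduces
  itself with \<open>\<sigma>\<close> squared. The integer \<open>t\<close> is the product of the
  differences \<open>y' - y\<close>, while the degrees lost accumulate to the factorial. After the
  first step \<open>g\<close> takes the place of \<open>F\<close>.\<close>

lemma van_der_Corput_to_linear:
  fixes F g :: "complex \<Rightarrow> real" and m :: nat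
  defines "Y \<equiv> of_nat ` {1..m} :: complex set"
  assumes fin: "finite \<Lambda>" "finite Z" and Z: "Z \<noteq> {}"
    and supp: "\<And>x. x \<notin> \<Lambda> \<Longrightarrow> g x = 0"
    and g2: "(\<Sum>x\<in>\<Lambda>. (g x)\<^sup>2) \<le> G" and F2: "(\<Sum>x\<in>\<Lambda>. (F x)\<^sup>2) \<le> G"
    and G: "G > 0" and sigma: "0 < \<sigma>" "\<sigma> \<le> 1" and m: "1 \<le> \<sigma> ^ (2 ^ j) * real m"
    and deg: "degree p \<le> Suc j"
    and big: "2 * \<sigma> * real m ^ j * real (card Z) * G \<le>
      \<bar>\<Sum>ys | set ys \<subseteq> Y \<and> length ys = j. \<Sum>z\<in>Z. \<Sum>x\<in>\<Lambda>. F x * g (x + poly p (sum_list ys + z))\<bar>"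
  shows "\<exists>(t::int) b F'. t \<noteq> 0 \<and> \<bar>t\<bar> \<le> int m ^ j \<and> (\<Sum>x\<in>\<Lambda>. (F' x)\<^sup>2) \<le> G \<and>
    2 * \<sigma> ^ (2 ^ j) * real (card Z) * G \<le>
      \<bar>\<Sum>z\<in>Z. \<Sum>x\<in>\<Lambda>. F' x * g (x + b + fact (Suc j) * coeff p (Suc j) * of_int t * z)\<bar>"
  using F2 sigma m deg big
proof (induction j arbitrary: F \<sigma> p)
  case 0
  obtain b q where p: "p = pCons b q" by (cases p)
  with 0(5) have "degree q = 0" by (auto split: if_splits)
  then obtain a where "q = [:a:]" by (rule degree_eq_zeroE)
  moreover have "{ys. set ys \<subseteq> Y \<and> length ys = 0} = {[]}" by auto
  ultimately show ?case
    using 0(1,6) p by (intro exI[of _ "1::int"] exI[of _ b] exI[of _ F]) (simp add: algebra_simps)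
next
  case (Suc j)
  \<comment> \<open>Only the first list entry is differenced; all remaining variables, including
    \<open>z\<close>, form the index set that stays outside the square.\<close>
  define V where "V = {ys. set ys \<subseteq> Y \<and> length ys = j} \<times> Z"
  have finY: "finite Y" by (simp add: Y_def)
  have cardY: "card Y = m" by (simp add: Y_def card_image)
  have mpos: "m > 0" using Suc.prems(4) by (cases m) auto
  have finV: "finite V" using fin finY by (simp add: V_def finite_lists_length_eq)
  have cardV: "real (card V) = real m ^ j * real (card Z)"
    by (simp add: V_def card_cartesian_product card_lists_length_eq finY cardY)
  have "card V \<noteq> 0"
    using cardV mpos fin Z by (metis mult_eq_0_iff of_nat_0 of_nat_eq_0_iff power_eq_0_iff card_0_eq not_gr0)
  then have V: "V \<noteq> {}" by auto
  have pow: "\<sigma> ^ (2 ^ Suc j) = (\<sigma>\<^sup>2) ^ (2 ^ j)" by (simp add: power_mult)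
  \<comment> \<open>As \<open>\<sigma> \<le> 1\<close>, the lower bound on \<open>m\<close> demanded
    by the whole induction also covers the present step.\<close>
  have "(\<sigma>\<^sup>2) ^ (2 ^ j) \<le> (\<sigma>\<^sup>2) ^ 1"
    using Suc.prems(2,3) by (intro power_decreasing) (auto simp: power_le_one)
  then have "(\<sigma>\<^sup>2) ^ (2 ^ j) * real m \<le> \<sigma>\<^sup>2 * real m"
    by (intro mult_right_mono) auto
  then have "1 \<le> \<sigma>\<^sup>2 * real m"
    using Suc.prems(4) unfolding pow by linarith
  moreover have "(2 * \<sigma>)\<^sup>2 * real (card Y) = 4 * (\<sigma>\<^sup>2 * real m)"
    by (simp add: cardY power_mult_distrib)
  ultimately have Ybig: "2 \<le> (2 * \<sigma>)\<^sup>2 * real (card Y)" by linarith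
  have "(\<Sum>v\<in>V. \<Sum>y\<in>Y. \<Sum>x\<in>\<Lambda>. F x * g (x + poly p (y + (sum_list (fst v) + snd v)))) =
    (\<Sum>ys | set ys \<subseteq> Y \<and> length ys = Suc j. \<Sum>z\<in>Z. \<Sum>x\<in>\<Lambda>. F x * g (x + poly p (sum_list ys + z)))"
    unfolding sum_lists_length_Suc V_def
    by (subst sum.swap, subst sum.cartesian_product') (simp add: add.assoc)
  then have "2 * \<sigma> * real (card V) * real (card Y) * G \<le>
      \<bar>\<Sum>v\<in>V. \<Sum>y\<in>Y. \<Sum>x\<in>\<Lambda>. F x * g (x + poly p (y + (sum_list (fst v) + snd v)))\<bar>"
    using Suc.prems(6) by (simp add: cardV cardY mult_ac)
  from van_der_Corput_step[OF fin(1) finV finY V supp g2 Suc.prems(1) G _ Ybig this]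
  obtain y y' where yy: "y \<in> Y" "y' \<in> Y" "y \<noteq> y'" and
    big': "(2 * \<sigma>)\<^sup>2 / 2 * real (card V) * G \<le> \<bar>\<Sum>v\<in>V. \<Sum>x\<in>\<Lambda>. g x * g (x +
      (poly p (y' + (sum_list (fst v) + snd v)) - poly p (y + (sum_list (fst v) + snd v))))\<bar>"
    using Suc.prems(2) by auto
  define r where "r = p \<circ>\<^sub>p [:y', 1:] - p \<circ>\<^sub>p [:y, 1:]"
  note r = difference_poly[OF Suc.prems(5), of y' y, folded r_def]
  have "(\<Sum>v\<in>V. \<Sum>x\<in>\<Lambda>. g x * g (x + poly r (sum_list (fst v) + snd v))) =
    (\<Sum>ys | set ys \<subseteq> Y \<and> length ys = j. \<Sum>z\<in>Z. \<Sum>x\<in>\<Lambda>. g x * g (x + poly r (sum_list ys + z)))"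
    unfolding V_def by (subst sum.cartesian_product') simp
  then have big'': "2 * \<sigma>\<^sup>2 * real m ^ j * real (card Z) * G \<le>
    \<bar>\<Sum>ys | set ys \<subseteq> Y \<and> length ys = j. \<Sum>z\<in>Z. \<Sum>x\<in>\<Lambda>. g x * g (x + poly r (sum_list ys + z))\<bar>"
    using big' by (simp add: r(3) cardV power_mult_distrib mult_ac)
  from Suc.IH[OF g2 _ _ _ r(1) big''] Suc.prems(2,3,4)
  obtain t b F' where t: "t \<noteq> 0" "\<bar>t\<bar> \<le> int m ^ j" and F': "(\<Sum>x\<in>\<Lambda>. (F' x)\<^sup>2) \<le> G"
    and fin_big: "2 * (\<sigma>\<^sup>2) ^ (2 ^ j) * real (card Z) * G \<le>
      \<bar>\<Sum>z\<in>Z. \<Sum>x\<in>\<Lambda>. F' x * g (x + b + fact (Suc j) * coeff r (Suc j) * of_int t * z)\<bar>"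
    unfolding pow by (auto simp: power_le_one)
  obtain k k' where k: "k \<in> {1..m}" "k' \<in> {1..m}" "y = of_nat k" "y' = of_nat k'"
    using yy by (auto simp: Y_def)
  define s where "s = int k' - int k"
  have s: "s \<noteq> 0" "\<bar>s\<bar> \<le> int m" "y' - y = of_int s"
    using k yy by (auto simp: s_def)
  have slope: "fact (Suc j) * coeff r (Suc j) * of_int t =
      fact (Suc (Suc j)) * coeff p (Suc (Suc j)) * (of_int (t * s) :: complex)"
    unfolding r(2) s(3) by (simp add: algebra_simps)
  show ?case
  proof (intro exI conjI)
    show "t * s \<noteq> 0" using t s by simp
    have "\<bar>t * s\<bar> \<le> int m ^ j * int m"
      unfolding abs_mult using t s by (intro mult_mono) auto
    then show "\<bar>t * s\<bar> \<le> int m ^ Suc j" by (simp add: mult.commute)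
    show "(\<Sum>x\<in>\<Lambda>. (F' x)\<^sup>2) \<le> G" by (rule F')
    show "2 * \<sigma> ^ (2 ^ Suc j) * real (card Z) * G \<le>
        \<bar>\<Sum>z\<in>Z. \<Sum>x\<in>\<Lambda>. F' x * g (x + b + fact (Suc (Suc j)) * coeff p (Suc (Suc j)) * of_int (t * s) * z)\<bar>"
      using fin_big unfolding slope pow .
  qed
qed

section \<open>The density increment\<close>

text \<open>Cauchy-Schwarz in \<open>x\<close> removes the unknown weight \<open>F\<close>. The
  constant \<open>b\<close> only translates the inner sum and disappears once the square is summed
  over the full support \<open>\<Omega>\<close>.\<close>

lemma linear_correlation_second_moment:
  fixes F g :: "complex \<Rightarrow> real"
  assumes fin: "finite \<Lambda>" "finite Z" and supp: "\<And>x. x \<notin> \<Lambda> \<Longrightarrow> g x = 0"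
    and F2: "(\<Sum>x\<in>\<Lambda>. (F x)\<^sup>2) \<le> G" and G: "G > 0" and kappa: "\<kappa> \<ge> 0"
    and fin\<Omega>: "finite {u. \<exists>z\<in>Z. u + E * z \<in> \<Lambda>}"
    and big: "\<kappa> * real (card Z) * G \<le> \<bar>\<Sum>z\<in>Z. \<Sum>x\<in>\<Lambda>. F x * g (x + b + E * z)\<bar>"
  shows "\<kappa>\<^sup>2 * real (card Z) ^ 2 * G \<le> (\<Sum>u | \<exists>z\<in>Z. u + E * z \<in> \<Lambda>. (\<Sum>z\<in>Z. g (u + E * z))\<^sup>2)"
proof -
  define h where "h u = (\<Sum>z\<in>Z. g (u + E * z))" for u
  define \<Omega> where "\<Omega> = {u. \<exists>z\<in>Z. u + E * z \<in> \<Lambda>}"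
  have h0: "h u = 0" if "u \<notin> \<Omega>" for u
    using that unfolding h_def \<Omega>_def by (intro sum.neutral) (auto intro: supp)
  define S where "S = (\<Sum>z\<in>Z. \<Sum>x\<in>\<Lambda>. F x * g (x + b + E * z))"
  have S: "S = (\<Sum>x\<in>\<Lambda>. F x * h (x + b))"
    unfolding S_def h_def by (subst sum.swap) (simp add: sum_distrib_left)
  have "(\<Sum>x\<in>\<Lambda>. (h (x + b))\<^sup>2) = (\<Sum>u\<in>(\<lambda>x. x + b) ` \<Lambda>. (h u)\<^sup>2)"
    by (subst sum.reindex) (auto simp: inj_on_def)
  also have "\<dots> = (\<Sum>u\<in>(\<lambda>x. x + b) ` \<Lambda> \<inter> \<Omega>. (h u)\<^sup>2)"
    using fin h0 by (intro sum.mono_neutral_right) auto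
  also have "\<dots> \<le> (\<Sum>u\<in>\<Omega>. (h u)\<^sup>2)"
    using fin\<Omega> by (intro sum_mono2) (auto simp: \<Omega>_def)
  finally have h2: "(\<Sum>x\<in>\<Lambda>. (h (x + b))\<^sup>2) \<le> (\<Sum>u\<in>\<Omega>. (h u)\<^sup>2)" .
  have "(\<kappa> * real (card Z) * G)\<^sup>2 \<le> \<bar>S\<bar>\<^sup>2"
    using big kappa G unfolding S_def by (intro power_mono) auto
  also have "\<dots> \<le> (\<Sum>x\<in>\<Lambda>. (F x)\<^sup>2) * (\<Sum>x\<in>\<Lambda>. (h (x + b))\<^sup>2)"
    unfolding S power2_abs by (rule Cauchy_Schwarz_ineq_sum)
  also have "\<dots> \<le> G * (\<Sum>u\<in>\<Omega>. (h u)\<^sup>2)"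
    using F2 h2 G by (intro mult_mono) (auto intro!: sum_nonneg)
  finally have "G * (\<kappa>\<^sup>2 * real (card Z) ^ 2 * G) \<le> G * (\<Sum>u\<in>\<Omega>. (h u)\<^sup>2)"
    by (simp add: power2_eq_square mult_ac)
  then show ?thesis using G by (simp add: h_def \<Omega>_def)
qed

text \<open>If no translate of \<open>E * Z\<close> meets \<open>B\<close> in density above
  \<open>\<rho> + \<eta>\<close>, the local sums of \<open>g\<close> have a small positive part.
  Their total is zero, so their negative part is small too, and the trivial bound by
  \<open>card Z\<close> upgrades this to mean square. The difference
  \<open>card \<Omega> - card \<Lambda>\<close> pays for translates that stick out of
  \<open>\<Lambda>\<close>.\<close>

lemma balanced_second_moment_le:
  fixes B \<Lambda> Z :: "complex set" and E :: complex and \<rho> \<eta> :: real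
  defines "g \<equiv> (\<lambda>x. of_bool (x \<in> B) - \<rho> * of_bool (x \<in> \<Lambda>))"
    and "\<Omega> \<equiv> {u. \<exists>z\<in>Z. u + E * z \<in> \<Lambda>}"
  assumes fin: "finite \<Lambda>" "finite Z" "finite \<Omega>" and B: "B \<subseteq> \<Lambda>"
    and rho: "real (card B) = \<rho> * real (card \<Lambda>)" "0 \<le> \<rho>" "\<rho> \<le> 1" and eta: "\<eta> \<ge> 0"
    and incr: "\<And>u. real (card {z \<in> Z. u + E * z \<in> B}) \<le> (\<rho> + \<eta>) * real (card Z)"
  shows "(\<Sum>u\<in>\<Omega>. (\<Sum>z\<in>Z. g (u + E * z))\<^sup>2) \<le>
    2 * real (card Z) ^ 2 * (\<eta> * real (card \<Omega>) + real (card \<Omega>) - real (card \<Lambda>))"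
proof -
  define k where "k = real (card Z)"
  define s where "s u = (\<Sum>z\<in>Z. of_bool (u + E * z \<in> B) :: real)" for u
  define t where "t u = (\<Sum>z\<in>Z. of_bool (u + E * z \<in> \<Lambda>) :: real)" for u
  define e where "e u = (\<Sum>z\<in>Z. g (u + E * z))" for u
  have k: "k \<ge> 0" by (simp add: k_def)
  have e: "e u = s u - \<rho> * t u" for u
    by (simp add: e_def s_def t_def g_def sum_subtractf sum_distrib_left)
  have ik: "(\<lambda>u. u - E * z) ` \<Lambda> \<subseteq> \<Omega>" if "z \<in> Z" for z
    using that by (auto simp: \<Omega>_def intro!: bexI[of _ z])
  \<comment> \<open>For each fixed \<open>z\<close>, every point of \<open>\<Lambda>\<close> equals
    \<open>u + E * z\<close> for exactly one \<open>u\<close> in \<open>\<Omega>\<close>.\<close>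
  have sum_h: "(\<Sum>u\<in>\<Omega>. \<Sum>z\<in>Z. h (u + E * z)) = k * (\<Sum>x\<in>\<Lambda>. h x)"
    if h: "\<And>x. x \<notin> \<Lambda> \<Longrightarrow> h x = 0" for h :: "complex \<Rightarrow> real"
  proof -
    have "(\<Sum>u\<in>\<Omega>. \<Sum>z\<in>Z. h (u + E * z)) = (\<Sum>z\<in>Z. \<Sum>u\<in>\<Omega>. h (u + E * z) * 1)"
      by (subst sum.swap) simp
    also have "\<dots> = (\<Sum>z\<in>Z. \<Sum>x\<in>\<Lambda>. h x * 1)"
      by (intro sum.cong[OF refl] sum_shift_support[where h = "\<lambda>_. 1"] fin h ik)
    finally show ?thesis by (simp add: k_def)
  qed
  have "(\<Sum>x\<in>\<Lambda>. of_bool (x \<in> B)) = real (card B)"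
    using B fin by (simp add: Int_absorb1)
  then have "(\<Sum>x\<in>\<Lambda>. g x) = 0"
    using rho fin by (simp add: g_def sum_subtractf sum_distrib_left[symmetric])
  then have sum_e: "(\<Sum>u\<in>\<Omega>. e u) = 0"
    unfolding e_def using B by (subst sum_h) (auto simp: g_def)
  have sum_t: "(\<Sum>u\<in>\<Omega>. t u) = k * real (card \<Lambda>)"
    unfolding t_def using fin by (subst sum_h) auto
  \<comment> \<open>Combines \<open>(e u)\<^sup>2 \<le> k * \<bar>e u\<bar>\<close> with the fact
    that \<open>\<bar>e u\<bar>\<close> is twice the positive part minus \<open>e u\<close>; the
    positive part is at most \<open>\<eta> * k + (k - t u)\<close>. The term linear in
    \<open>e u\<close> vanishes on summation.\<close>
  have pointwise: "(e u)\<^sup>2 \<le> k * (2 * \<eta> * k + 2 * k - 2 * t u - e u)" for u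
  proof -
    have s0: "0 \<le> s u" and st: "s u \<le> t u" and tk: "t u \<le> k"
      unfolding s_def t_def k_def using B sum_mono[of Z "\<lambda>z. of_bool (u + E * z \<in> \<Lambda>)" "\<lambda>_. 1::real"]
      by (auto intro!: sum_nonneg sum_mono)
    have t0: "0 \<le> t u" using s0 st by simp
    have sle: "s u \<le> (\<rho> + \<eta>) * k"
      using incr[of u] fin unfolding s_def k_def by (simp add: Int_def)
    have "\<rho> * t u \<le> 1 * t u" "0 \<le> \<rho> * t u" using rho t0 by (auto intro: mult_left_le_one_le)
    then have abs_e: "\<bar>e u\<bar> \<le> k" using s0 st tk unfolding e by linarith
    have "\<rho> * (k - t u) \<le> 1 * (k - t u)" using rho tk by (intro mult_right_mono) auto
    then have "e u \<le> \<eta> * k + (k - t u)"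
      using sle unfolding e by (simp add: algebra_simps)
    moreover have "0 \<le> \<eta> * k + (k - t u)" using eta k tk by simp
    ultimately have "\<bar>e u\<bar> \<le> 2 * \<eta> * k + 2 * k - 2 * t u - e u" by (simp add: abs_if)
    then have "k * \<bar>e u\<bar> \<le> k * (2 * \<eta> * k + 2 * k - 2 * t u - e u)"
      using k by (rule mult_left_mono)
    moreover have "(e u)\<^sup>2 \<le> k * \<bar>e u\<bar>"
      using abs_e by (metis abs_ge_zero mult_right_mono power2_abs power2_eq_square)
    ultimately show ?thesis by linarith
  qed
  have "(\<Sum>u\<in>\<Omega>. (e u)\<^sup>2) \<le> (\<Sum>u\<in>\<Omega>. k * (2 * \<eta> * k + 2 * k - 2 * t u - e u))"
    by (intro sum_mono pointwise)
  also have "\<dots> = k * (real (card \<Omega>) * (2 * \<eta> * k + 2 * k) - 2 * (\<Sum>u\<in>\<Omega>. t u) - (\<Sum>u\<in>\<Omega>. e u))"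
    by (simp add: sum_distrib_left[symmetric] sum_subtractf)
  also have "\<dots> = 2 * k ^ 2 * (\<eta> * real (card \<Omega>) + real (card \<Omega>) - real (card \<Lambda>))"
    by (simp add: sum_e sum_t power2_eq_square algebra_simps)
  finally show ?thesis by (simp add: e_def k_def)
qed

lemma poly_norm_le_power_degree:
  fixes q :: "complex poly"
  assumes "1 \<le> X" "cmod u \<le> X"
  shows "cmod (poly q u) \<le> (\<Sum>i\<le>degree q. cmod (coeff q i)) * X ^ degree q"
proof -
  have "cmod (poly q u) \<le> (\<Sum>i\<le>degree q. cmod (coeff q i * u ^ i))"
    unfolding poly_altdef by (rule norm_sum)
  also have "\<dots> \<le> (\<Sum>i\<le>degree q. cmod (coeff q i) * X ^ degree q)"
  proof (rule sum_mono)
    fix i assume "i \<in> {..degree q}"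
    then have "cmod u ^ i \<le> X ^ degree q"
      using assms by (meson atMost_iff norm_ge_zero order_trans power_increasing power_mono)
    then show "cmod (coeff q i * u ^ i) \<le> cmod (coeff q i) * X ^ degree q"
      by (simp add: norm_mult norm_power mult_left_mono)
  qed
  finally show ?thesis by (simp add: sum_distrib_right)
qed

text \<open>All losses are absorbed into powers of \<open>T\<close>. In \<open>K\<close>, the part
  \<open>1 + j + j * 2 ^ j\<close> bounds the slope \<open>E\<close>, \<open>2 ^ Suc j\<close>
  compensates the size of the increment, and one further factor \<open>T\<close> covers the constant
  32. The exponent \<open>j + 2\<close> in the bound for \<open>L\<close> exceeds the degree by one,
  so values of \<open>p\<close> are short compared with \<open>L\<close>.\<close>

lemma density_increment:
  fixes q :: "complex poly" and T M L j :: nat and \<delta> \<rho> :: real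
  defines "K \<equiv> 2 + j + j * 2 ^ j + 2 ^ Suc j"
  assumes q: "gauss_poly q" "intersective q" "degree q = Suc j"
    and D: "gauss_int D" "D \<noteq> 0" "cmod D \<le> real T"
    and delta: "0 < \<delta>" "\<delta> \<le> \<rho>" "\<rho> \<le> 1"
    and T_delta: "1 \<le> \<delta>\<^sup>2 / 4 * real T"
    and T_32: "32 \<le> T"
    and T_lead: "fact (Suc j) * cmod (lead_coeff q) \<le> real T"
    and T_coeffs: "8 * (\<Sum>i\<le>degree q. cmod (coeff q i)) * real (j + 3) ^ Suc j \<le> \<delta> * real T"
    and T_degree: "4 * real (Suc j) \<le> \<delta> * real T"
    and M: "T ^ K \<le> M" and L: "M ^ (j + 2) \<le> L"
    and A: "\<forall>a\<in>A. \<forall>b\<in>A. a \<noteq> b \<longrightarrow> \<not> (\<exists>z. gauss_int z \<and> a - b = poly q z)"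
    and dens: "real (card {x \<in> gbox (real L). x0 + D * x \<in> A}) = \<rho> * real L ^ 2"
  shows "\<exists>x' D'. gauss_int D' \<and> D' \<noteq> 0 \<and> cmod D' \<le> real (T ^ K) \<and>
    (\<rho> + (\<delta>\<^sup>2 / 4) ^ (2 ^ Suc j) / 2) * real M ^ 2 \<le> real (card {z \<in> gbox (real M). x' + D' * z \<in> A})"
proof -
  define \<sigma> where "\<sigma> = \<delta>\<^sup>2 / 4"
  \<comment> \<open>From \<open>1 \<le> \<sigma> * T\<close>, this is the power giving
    \<open>1 \<le> \<sigma> ^ (2 ^ j) * m\<close>, as the differencing requires.\<close>
  define m where "m = T ^ (2 ^ j)"
  define \<Lambda> where "\<Lambda> = gbox (real L)"
  define Z where "Z = gbox (real M)"
  define B where "B = {x \<in> \<Lambda>. x0 + D * x \<in> A}"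
  define g where "g = (\<lambda>x. of_bool (x \<in> B) - \<rho> * of_bool (x \<in> \<Lambda>) :: real)"
  define Q where "Q = (\<Sum>i\<le>degree q. cmod (coeff q i))"
  define Y where "Y = (of_nat ` {1..m} :: complex set)"
  have T: "1 \<le> T" using T_32 by simp
  have TM: "T ^ i \<le> M" if "i \<le> K" for i
    using power_increasing[OF that T] M by linarith
  have M1: "T \<le> M" using TM[of 1] by (simp add: K_def)
  have mM: "m \<le> M" unfolding m_def by (rule TM) (simp add: K_def)
  have M2: "M * M \<le> L"
  proof -
    have "M * M * 1 \<le> M * M * M ^ j" using M1 T by (intro mult_left_mono) auto
    also have "\<dots> = M ^ (j + 2)" by simp
    finally show ?thesis using L by linarith
  qed
  have Mpos: "M > 0" using M1 T by simp
  have Lpos: "L > 0" using M2 Mpos by (metis le_zero_eq mult_is_0 neq0_conv)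
  have sigma: "0 < \<sigma>" "\<sigma> \<le> 1"
    using delta power_le_one[of \<delta> 2] by (auto simp: \<sigma>_def)
  have sT: "1 \<le> \<sigma> * real T" using T_delta by (simp add: \<sigma>_def)
  have sm: "1 \<le> \<sigma> ^ (2 ^ j) * real m"
    using one_le_power[OF sT, of "2 ^ j"] by (simp add: m_def power_mult_distrib)
  have fin: "finite \<Lambda>" "finite Z" "finite Y" by (auto simp: \<Lambda>_def Z_def Y_def finite_gbox)
  have cardY: "card Y = m" by (simp add: Y_def card_image)
  have finB: "finite B" "B \<subseteq> \<Lambda>" using fin by (auto simp: B_def)
  have cL: "real (card \<Lambda>) = real L ^ 2" and cZ: "real (card Z) = real M ^ 2"
    by (simp_all add: \<Lambda>_def Z_def card_gbox)
  have cB: "real (card B) = \<rho> * real L ^ 2" using dens by (simp add: B_def \<Lambda>_def)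
  have Zne: "Z \<noteq> {}" using cZ Mpos by auto
  have rho: "0 < \<rho>" using delta by simp
  have D1: "1 \<le> cmod D"
  proof -
    obtain k l where kl: "D = Complex (of_int k) (of_int l)" using D gauss_int_obtain by metis
    then have "k \<noteq> 0 \<or> l \<noteq> 0" using D(2) by (auto simp: complex_eq_iff)
    then have "1 \<le> \<bar>real_of_int k\<bar> \<or> 1 \<le> \<bar>real_of_int l\<bar>" by linarith
    then show ?thesis using abs_Re_le_cmod[of D] abs_Im_le_cmod[of D] by (auto simp: kl)
  qed

  obtain r where r: "gauss_int r" "cmod r \<le> cmod D"
    "\<And>w. gauss_int w \<Longrightarrow> gauss_int (poly q (r + D * w) / D)"
    using intersective_root_mod[OF q(1,2) D(1,2)] by blast
  define p where "p = smult (1 / D) (q \<circ>\<^sub>p [:r, D:])"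
  have poly_p: "poly p w = poly q (r + D * w) / D" for w
    by (simp add: p_def poly_pcompose mult.commute)
  have deg_p: "degree p = Suc j"
    using D(2) by (simp add: p_def degree_pcompose q(3))
  have lead_p: "coeff p (Suc j) = lead_coeff q * D ^ j"
  proof -
    have "lead_coeff (q \<circ>\<^sub>p [:r, D:]) = lead_coeff q * D ^ Suc j"
      using D(2) lead_coeff_comp[of "[:r, D:]" q] by (simp add: q(3))
    then show ?thesis using D(2) by (simp add: p_def degree_pcompose q(3))
  qed

  \<comment> \<open>Bounds \<open>p\<close> at all arguments in use: there
    \<open>\<bar>r + D * w\<bar>\<close> is at most \<open>T * (j + 3) * M\<close>, and
    \<open>q\<close> has degree \<open>j + 1\<close>.\<close>
  define R where "R = Q * real (j + 3) ^ Suc j * real T ^ Suc j * real M ^ Suc j"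
  have Q0: "0 \<le> Q" by (auto simp: Q_def intro: sum_nonneg)
  have R_le: "8 * R \<le> \<delta> * real L"
  proof -
    have "8 * R = (8 * Q * real (j + 3) ^ Suc j) * (real T ^ Suc j * real M ^ Suc j)"
      by (simp add: R_def)
    also have "\<dots> \<le> \<delta> * real T * (real T ^ Suc j * real M ^ Suc j)"
      using T_coeffs by (intro mult_right_mono) (auto simp: Q_def)
    also have "\<dots> = \<delta> * (real (T ^ (j + 2)) * real M ^ Suc j)"
      by (simp add: mult_ac)
    also have "\<dots> \<le> \<delta> * (real M * real M ^ Suc j)"
    proof (intro mult_left_mono mult_right_mono)
      show "real (T ^ (j + 2)) \<le> real M"
        unfolding of_nat_le_iff by (rule TM) (simp add: K_def)
    qed (use delta in auto)
    also have "\<dots> = \<delta> * real (M ^ (j + 2))" by simp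
    also have "\<dots> \<le> \<delta> * real L"
    proof (rule mult_left_mono)
      show "real (M ^ (j + 2)) \<le> real L" unfolding of_nat_le_iff by (rule L)
    qed (use delta in auto)
    finally show ?thesis .
  qed
  have s_gauss: "gauss_int (sum_list ys + z)" if "set ys \<subseteq> Y" "z \<in> Z" for ys z
    using that
    by (intro gauss_int_add gauss_int_sum_list)
      (auto simp: Y_def Z_def gauss_int_of_nat intro: gbox_gauss_int)
  have p_gauss: "gauss_int (poly p (sum_list ys + z))" if "set ys \<subseteq> Y" "z \<in> Z" for ys z
    using r(3)[OF s_gauss[OF that]] by (simp add: poly_p)
  have p_le: "cmod (poly p (sum_list ys + z)) \<le> R" if "set ys \<subseteq> Y" "length ys = j" "z \<in> Z" for ys z
  proof -
    have "cmod (sum_list ys) \<le> real (length ys) * real m" if "set ys \<subseteq> Y" for ys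
      using that
    proof (induction ys)
      case (Cons y ys)
      then have "cmod y \<le> real m" by (auto simp: Y_def)
      then show ?case using Cons norm_triangle_ineq[of y "sum_list ys"] by (auto simp: algebra_simps)
    qed auto
    then have "cmod (sum_list ys) \<le> real j * real m" using that by metis
    also have "\<dots> \<le> real j * real M" using mM by (intro mult_left_mono) auto
    finally have "cmod (sum_list ys + z) \<le> real j * real M + 2 * real M"
      using norm_triangle_ineq[of "sum_list ys" z] gbox_cmod_le[of z M] that(3) by (auto simp: Z_def)
    then have "cmod (D * (sum_list ys + z)) \<le> cmod D * (real j * real M + 2 * real M)"
      by (simp add: norm_mult mult_left_mono)
    then have "cmod (r + D * (sum_list ys + z)) \<le> cmod D + cmod D * (real j * real M + 2 * real M)"
      using norm_triangle_ineq[of r "D * (sum_list ys + z)"] r(2) by linarith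
    also have "\<dots> = cmod D * (1 + real j * real M + 2 * real M)" by (simp add: algebra_simps)
    also have "\<dots> \<le> real T * (real (j + 3) * real M)"
      using D(3) Mpos by (intro mult_mono) (auto simp: algebra_simps)
    finally have u: "cmod (r + D * (sum_list ys + z)) \<le> real T * (real (j + 3) * real M)" .
    have "1 \<le> T * ((j + 3) * M)" using T Mpos by (simp add: Suc_le_eq)
    then have X: "1 \<le> real T * (real (j + 3) * real M)"
      by (metis of_nat_1 of_nat_le_iff of_nat_mult)
    have "cmod (poly q (r + D * (sum_list ys + z))) \<le> Q * (real T * (real (j + 3) * real M)) ^ Suc j"
      using poly_norm_le_power_degree[OF X u, of q] by (simp only: Q_def q(3))
    also have "\<dots> = R" by (simp only: R_def power_mult_distrib mult_ac)
    finally have "cmod (poly q (r + D * (sum_list ys + z))) \<le> R" .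
    moreover have "cmod (poly q (r + D * (sum_list ys + z))) / cmod D \<le> cmod (poly q (r + D * (sum_list ys + z)))"
      using D1 by (simp add: divide_le_eq mult_right_le_one_le mult_le_cancel_left1)
    ultimately show ?thesis by (simp add: poly_p norm_divide)
  qed

  \<comment> \<open>For a nonzero value \<open>u\<close> of \<open>p\<close>, the sets
    \<open>B\<close> and \<open>B - u\<close> are disjoint, since \<open>D * u\<close> is a value of
    \<open>q\<close>. Only the negative term of \<open>g\<close> survives, and the boundary costs at
    most a quarter of \<open>B\<close>. If \<open>u = 0\<close>, the first sum is at most
    \<open>card B\<close>.\<close>
  have inner: "(\<Sum>x\<in>\<Lambda>. of_bool (x \<in> B) * g (x + u)) \<le>
      \<rho> * real L ^ 2 * of_bool (u = 0) - 3 / 4 * (\<rho>\<^sup>2 * real L ^ 2)"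
    if u: "gauss_int u" "cmod u \<le> R" "\<exists>w. gauss_int w \<and> u = poly p w" for u
  proof -
    have avoid: "x + u \<notin> B" if "x \<in> B" "u \<noteq> 0" for x
    proof
      assume "x + u \<in> B"
      then have "x0 + D * (x + u) \<in> A" "x0 + D * x \<in> A" using that by (auto simp: B_def)
      moreover have "x0 + D * (x + u) \<noteq> x0 + D * x" using D(2) that by simp
      moreover obtain w where "gauss_int w" "u = poly p w" using u by blast
      then have "x0 + D * (x + u) - (x0 + D * x) = poly q (r + D * w)" "gauss_int (r + D * w)"
        using D r by (auto simp: poly_p algebra_simps intro!: gauss_int_add gauss_int_mult)
      ultimately show False using A by blast
    qed
    have "(\<Sum>x\<in>\<Lambda>. of_bool (x \<in> B) * of_bool (x + u \<in> B)) \<le> (\<Sum>x\<in>\<Lambda>. of_bool (x \<in> B) * of_bool (u = 0) :: real)"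
      using avoid by (intro sum_mono) auto
    also have "\<dots> = \<rho> * real L ^ 2 * of_bool (u = 0)"
      using fin finB cB by (simp add: sum_distrib_right[symmetric] Int_absorb1)
    finally have 1: "(\<Sum>x\<in>\<Lambda>. of_bool (x \<in> B) * of_bool (x + u \<in> B)) \<le> \<rho> * real L ^ 2 * of_bool (u = 0)" .
    have "real (card {x \<in> \<Lambda>. x + u \<notin> \<Lambda>}) \<le> 2 * real L * R"
      unfolding \<Lambda>_def by (rule card_gbox_shift_out[OF u(1,2)])
    also have "\<dots> \<le> real L * (\<delta> * real L) / 4"
      using mult_left_mono[OF R_le, of "real L"] by simp
    also have "\<dots> \<le> \<rho> * real L ^ 2 / 4"
      using mult_right_mono[OF delta(2), of "real L ^ 2"] by (simp add: power2_eq_square mult_ac)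
    finally have out: "real (card {x \<in> \<Lambda>. x + u \<notin> \<Lambda>}) \<le> \<rho> * real L ^ 2 / 4" .
    have "\<rho> * real L ^ 2 - real (card {x \<in> \<Lambda>. x + u \<notin> \<Lambda>}) = (\<Sum>x\<in>\<Lambda>. of_bool (x \<in> B) - of_bool (x + u \<notin> \<Lambda>))"
      using fin finB cB Int_absorb1[OF finB(2)] by (simp add: sum_subtractf Int_def)
    also have "\<dots> \<le> (\<Sum>x\<in>\<Lambda>. of_bool (x \<in> B) * of_bool (x + u \<in> \<Lambda>))"
      by (intro sum_mono) auto
    finally have "3 / 4 * (\<rho> * real L ^ 2) \<le> (\<Sum>x\<in>\<Lambda>. of_bool (x \<in> B) * of_bool (x + u \<in> \<Lambda>))"
      using out by linarith
    then have "\<rho> * (3 / 4 * (\<rho> * real L ^ 2)) \<le> \<rho> * (\<Sum>x\<in>\<Lambda>. of_bool (x \<in> B) * of_bool (x + u \<in> \<Lambda>))"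
      using rho by (intro mult_left_mono) auto
    moreover have "(\<Sum>x\<in>\<Lambda>. of_bool (x \<in> B) * g (x + u)) = (\<Sum>x\<in>\<Lambda>. of_bool (x \<in> B) * of_bool (x + u \<in> B))
        - \<rho> * (\<Sum>x\<in>\<Lambda>. of_bool (x \<in> B) * of_bool (x + u \<in> \<Lambda>))"
      by (simp add: g_def algebra_simps sum_subtractf sum_distrib_left)
    ultimately show ?thesis using 1 by (simp add: power2_eq_square algebra_simps)
  qed

  \<comment> \<open>The shift is zero for at most \<open>j + 1\<close> of the \<open>z\<close>,
    which costs another quarter. What remains is half of \<open>\<rho>\<^sup>2\<close>, at least
    \<open>\<delta>\<^sup>2 / 2 = 2 * \<sigma>\<close>.\<close>
  have z_sum: "(\<Sum>z\<in>Z. \<Sum>x\<in>\<Lambda>. of_bool (x \<in> B) * g (x + poly p (sum_list ys + z))) \<le>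
      - (2 * \<sigma> * real M ^ 2 * real L ^ 2)"
    if ys: "set ys \<subseteq> Y" "length ys = j" for ys
  proof -
    define h where "h = p \<circ>\<^sub>p [:sum_list ys, 1:]"
    have h: "poly h z = poly p (sum_list ys + z)" for z by (simp add: h_def poly_pcompose add.commute)
    have deg_h: "degree h = Suc j" by (simp add: h_def degree_pcompose deg_p)
    then have h0: "h \<noteq> 0" by auto
    have "card {z \<in> Z. poly h z = 0} \<le> card {z. poly h z = 0}"
      using poly_roots_finite[OF h0] by (intro card_mono) auto
    also have "\<dots> \<le> Suc j" using card_poly_roots_bound[OF h0] deg_h by simp
    finally have "real (card {z \<in> Z. poly h z = 0}) \<le> real (Suc j)" by simp
    also have "\<dots> \<le> \<rho> * real M ^ 2 / 4"
    proof -
      have "4 * real (Suc j) \<le> \<rho> * real T"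
        using T_degree delta(2) by (meson mult_right_mono of_nat_0_le_iff order_trans)
      also have "\<dots> \<le> \<rho> * real M ^ 2"
      proof -
        have "T * 1 \<le> M * M" using M1 Mpos by (intro mult_mono) auto
        then have "real T \<le> real M ^ 2" by (metis mult_1_right of_nat_le_iff of_nat_power power2_eq_square)
        then show ?thesis using rho by simp
      qed
      finally show ?thesis by simp
    qed
    finally have roots: "real (card {z \<in> Z. poly h z = 0}) \<le> \<rho> * real M ^ 2 / 4" .
    have "(\<Sum>z\<in>Z. \<Sum>x\<in>\<Lambda>. of_bool (x \<in> B) * g (x + poly p (sum_list ys + z))) \<le>
      (\<Sum>z\<in>Z. \<rho> * real L ^ 2 * of_bool (poly h z = 0) - 3 / 4 * (\<rho>\<^sup>2 * real L ^ 2))"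
      unfolding h using ys s_gauss by (intro sum_mono inner p_gauss p_le) auto
    also have "\<dots> = \<rho> * real L ^ 2 * real (card {z \<in> Z. poly h z = 0}) - real M ^ 2 * (3 / 4 * (\<rho>\<^sup>2 * real L ^ 2))"
      using fin cZ by (simp add: sum_subtractf sum_distrib_left[symmetric] Int_def)
    also have "\<dots> \<le> \<rho> * real L ^ 2 * (\<rho> * real M ^ 2 / 4) - real M ^ 2 * (3 / 4 * (\<rho>\<^sup>2 * real L ^ 2))"
      using roots rho by (intro diff_right_mono mult_left_mono) auto
    also have "\<dots> = - (\<rho>\<^sup>2 * (real M ^ 2 * real L ^ 2) / 2)" by (simp add: power2_eq_square)
    also have "\<dots> \<le> - (\<delta>\<^sup>2 * (real M ^ 2 * real L ^ 2) / 2)"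
      using delta by (simp add: mult_right_mono power_mono)
    finally show ?thesis by (simp add: \<sigma>_def)
  qed
  have "(\<Sum>ys | set ys \<subseteq> Y \<and> length ys = j. \<Sum>z\<in>Z. \<Sum>x\<in>\<Lambda>.
      of_bool (x \<in> B) * g (x + poly p (sum_list ys + z))) \<le>
    (\<Sum>ys | set ys \<subseteq> Y \<and> length ys = j. - (2 * \<sigma> * real M ^ 2 * real L ^ 2))"
    by (intro sum_mono z_sum) auto
  also have "\<dots> = - (2 * \<sigma> * real m ^ j * real (card Z) * real L ^ 2)"
    by (simp add: card_lists_length_eq fin cardY cZ)
  finally have big: "2 * \<sigma> * real m ^ j * real (card Z) * real L ^ 2 \<le>
    \<bar>\<Sum>ys | set ys \<subseteq> Y \<and> length ys = j. \<Sum>z\<in>Z. \<Sum>x\<in>\<Lambda>.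
      of_bool (x \<in> B) * g (x + poly p (sum_list ys + z))\<bar>"
    by linarith

  have gsupp: "g x = 0" if "x \<notin> \<Lambda>" for x using that finB by (auto simp: g_def)
  have "(g x)\<^sup>2 \<le> 1" for x
    using rho delta finB by (auto simp: g_def power_le_one power2_le_iff_abs_le)
  then have "(\<Sum>x\<in>\<Lambda>. (g x)\<^sup>2) \<le> (\<Sum>x\<in>\<Lambda>. 1)" by (intro sum_mono)
  then have g2: "(\<Sum>x\<in>\<Lambda>. (g x)\<^sup>2) \<le> real L ^ 2" using cL by simp
  have "(\<Sum>x\<in>\<Lambda>. (of_bool (x \<in> B) :: real)\<^sup>2) \<le> (\<Sum>x\<in>\<Lambda>. 1)" by (intro sum_mono) auto
  then have F2: "(\<Sum>x\<in>\<Lambda>. (of_bool (x \<in> B) :: real)\<^sup>2) \<le> real L ^ 2" using cL by simp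
  have L2: "real L ^ 2 > 0" using Lpos by simp
  obtain t b F' where t: "t \<noteq> 0" "\<bar>t\<bar> \<le> int m ^ j" and F': "(\<Sum>x\<in>\<Lambda>. (F' x)\<^sup>2) \<le> real L ^ 2"
    and lin: "2 * \<sigma> ^ (2 ^ j) * real (card Z) * real L ^ 2 \<le>
      \<bar>\<Sum>z\<in>Z. \<Sum>x\<in>\<Lambda>. F' x * g (x + b + fact (Suc j) * coeff p (Suc j) * of_int t * z)\<bar>"
    using van_der_Corput_to_linear[OF fin(1,2) Zne gsupp g2 F2 L2 sigma sm, of p] deg_p big
    unfolding Y_def by auto

  define E where "E = fact (Suc j) * coeff p (Suc j) * of_int t"
  have E0: "E \<noteq> 0"
  proof -
    have "q \<noteq> 0" using q(3) by auto
    then have "lead_coeff q \<noteq> 0" by (rule leading_coeff_neq_0)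
    then show ?thesis using t D(2) by (simp add: E_def lead_p del: fact_Suc)
  qed
  have E_gauss: "gauss_int E"
    unfolding E_def lead_p using q(1) D(1)
    by (intro gauss_int_mult gauss_int_power gauss_int_of_int)
      (auto simp: gauss_poly_def gauss_int_of_nat[of "fact (Suc j)", unfolded of_nat_fact] simp del: fact_Suc)
  define e where "e = 1 + j + j * 2 ^ j"
  have E_le: "cmod E \<le> real (T ^ e)"
  proof -
    have "cmod E = fact (Suc j) * cmod (lead_coeff q) * cmod D ^ j * \<bar>of_int t\<bar>"
      by (simp add: E_def lead_p norm_mult norm_power norm_fact del: fact_Suc)
    also have "\<dots> \<le> real T * real T ^ j * real (m ^ j)"
    proof (intro mult_mono)
      have "real_of_int \<bar>t\<bar> \<le> real_of_int (int m ^ j)" using t(2) by (simp only: of_int_le_iff)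
      then show "\<bar>real_of_int t\<bar> \<le> real (m ^ j)" by simp
    qed (use T_lead D in \<open>auto intro: power_mono\<close>)
    also have "\<dots> = real (T ^ e)"
      by (simp add: e_def m_def power_add power_mult[symmetric] mult_ac)
    finally show ?thesis .
  qed
  define S where "S = 2 * M * T ^ e"
  have near: "gauss_int (E * z) \<and> cmod (E * z) \<le> real S" if "z \<in> Z" for z
  proof -
    have "cmod (E * z) \<le> real (T ^ e) * (2 * real M)"
      unfolding norm_mult using E_le gbox_cmod_le[of z M] that by (intro mult_mono) (auto simp: Z_def)
    then show ?thesis using that E_gauss by (auto simp: S_def Z_def mult_ac intro: gauss_int_mult gbox_gauss_int)
  qed
  define \<Omega> where "\<Omega> = {u. \<exists>z\<in>Z. u + E * z \<in> \<Lambda>}"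
  have fin\<Omega>: "finite \<Omega>" and c\<Omega>: "card \<Omega> \<le> (L + 2 * S) ^ 2"
    using card_gbox_neighbourhood[of Z E S L] near by (auto simp: \<Omega>_def \<Lambda>_def)
  \<comment> \<open>Chosen so that the squared correlation constant
    \<open>(2 * \<sigma> ^ (2 ^ j))\<^sup>2\<close> equals \<open>8 * \<eta>\<close>.\<close>
  define \<eta> where "\<eta> = \<sigma> ^ (2 ^ Suc j) / 2"
  have eta: "0 < \<eta>" "\<eta> \<le> 1/2" using sigma by (auto simp: \<eta>_def power_le_one)
  have lower: "8 * \<eta> * real (card Z) ^ 2 * real L ^ 2 \<le> (\<Sum>u\<in>\<Omega>. (\<Sum>z\<in>Z. g (u + E * z))\<^sup>2)"
  proof -
    have "(2 * \<sigma> ^ (2 ^ j))\<^sup>2 * real (card Z) ^ 2 * real L ^ 2 \<le> (\<Sum>u\<in>\<Omega>. (\<Sum>z\<in>Z. g (u + E * z))\<^sup>2)"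
      unfolding \<Omega>_def
      using linear_correlation_second_moment[OF fin(1,2) gsupp F' L2 _ fin\<Omega>[unfolded \<Omega>_def],
        where \<kappa> = "2 * \<sigma> ^ (2 ^ j)" and b = b]
        lin sigma by (simp add: E_def)
    moreover have "(2 * \<sigma> ^ (2 ^ j))\<^sup>2 = 8 * \<eta>"
      by (simp add: \<eta>_def power_mult_distrib power_mult[symmetric] mult.commute)
    ultimately show ?thesis by simp
  qed
  have "\<exists>u. (\<rho> + \<eta>) * real (card Z) < real (card {z \<in> Z. u + E * z \<in> B})"
  proof (rule ccontr)
    assume "\<not> ?thesis"
    then have "(\<Sum>u\<in>\<Omega>. (\<Sum>z\<in>Z. g (u + E * z))\<^sup>2) \<le>
        2 * real (card Z) ^ 2 * (\<eta> * real (card \<Omega>) + real (card \<Omega>) - real (card \<Lambda>))"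
      unfolding g_def \<Omega>_def
      using balanced_second_moment_le[OF fin(1,2) fin\<Omega>[unfolded \<Omega>_def] finB(2), of \<rho> \<eta>] cB cL rho delta eta
      by (auto simp: not_less)
    moreover have "8 * \<eta> * real (card Z) ^ 2 * real L ^ 2 = 2 * real (card Z) ^ 2 * (4 * \<eta> * real L ^ 2)"
      by simp
    ultimately have "2 * real (card Z) ^ 2 * (4 * \<eta> * real L ^ 2) \<le>
        2 * real (card Z) ^ 2 * (\<eta> * real (card \<Omega>) + real (card \<Omega>) - real (card \<Lambda>))"
      using lower by linarith
    then have le: "4 * \<eta> * real L ^ 2 \<le> \<eta> * real (card \<Omega>) + real (card \<Omega>) - real L ^ 2"
      using cZ Mpos cL by simp
    \<comment> \<open>With \<open>S \<le> \<theta> * L\<close>, enlarging the box by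
      \<open>S\<close> on each side multiplies its size by at most
      \<open>1 + 8 * \<theta> = 1 + \<eta>\<close>. The upper bound then becomes
      \<open>2 * \<eta> + \<eta> * \<eta>\<close>, below the required
      \<open>4 * \<eta>\<close>.\<close>
    define \<theta> where "\<theta> = \<eta> / 8"
    have S_le: "real S \<le> \<theta> * real L"
    proof -
      have "1 \<le> (\<sigma> * real T) ^ (2 ^ Suc j)" using sT by (rule one_le_power)
      then have "1 \<le> 2 * \<eta> * real T ^ (2 ^ Suc j)" by (simp add: \<eta>_def power_mult_distrib)
      then have "real S * 1 \<le> real S * (2 * \<eta> * real T ^ (2 ^ Suc j))" by (intro mult_left_mono) auto
      also have "\<dots> = \<theta> * (32 * (real M * real T ^ (e + 2 ^ Suc j)))"
        by (simp add: S_def \<theta>_def power_add)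
      also have "\<dots> \<le> \<theta> * real L"
      proof (rule mult_left_mono)
        have "32 * (M * T ^ (e + 2 ^ Suc j)) \<le> T * (M * T ^ (e + 2 ^ Suc j))"
          using T_32 by (intro mult_right_mono) auto
        also have "\<dots> = M * T ^ K"
          by (simp add: K_def e_def power_add)
        also have "\<dots> \<le> M * M" using M by (intro mult_left_mono) auto
        finally have "32 * (M * T ^ (e + 2 ^ Suc j)) \<le> L" using M2 by linarith
        then have "real (32 * (M * T ^ (e + 2 ^ Suc j))) \<le> real L" by (simp only: of_nat_le_iff)
        then show "32 * (real M * real T ^ (e + 2 ^ Suc j)) \<le> real L" by simp
      qed (use eta in \<open>simp add: \<theta>_def\<close>)
      finally show ?thesis by simp
    qed
    have "real (card \<Omega>) \<le> real ((L + 2 * S) ^ 2)" using c\<Omega> by (simp only: of_nat_le_iff)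
    also have "\<dots> \<le> (real L + 2 * (\<theta> * real L)) ^ 2"
      using S_le by (simp add: power_mono)
    also have "\<dots> = (1 + 4 * \<theta> + 4 * \<theta>\<^sup>2) * real L ^ 2"
      by (simp add: power2_eq_square algebra_simps)
    also have "\<dots> \<le> (1 + \<eta>) * real L ^ 2"
    proof (rule mult_right_mono)
      have "\<theta> * \<theta> \<le> \<theta> * 1" using eta by (intro mult_left_mono) (auto simp: \<theta>_def)
      then show "1 + 4 * \<theta> + 4 * \<theta>\<^sup>2 \<le> 1 + \<eta>" by (simp add: power2_eq_square \<theta>_def)
    qed simp
    finally have c: "real (card \<Omega>) \<le> (1 + \<eta>) * real L ^ 2" .
    have "(1 + \<eta>) * real (card \<Omega>) \<le> (1 + \<eta>) * ((1 + \<eta>) * real L ^ 2)"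
      using c eta by (intro mult_left_mono) auto
    then have "4 * \<eta> * real L ^ 2 \<le> (2 * \<eta> + \<eta> * \<eta>) * real L ^ 2"
      using le by (simp add: algebra_simps)
    then have "4 * \<eta> \<le> 2 * \<eta> + \<eta> * \<eta>" using L2 by simp
    moreover have "\<eta> * \<eta> \<le> \<eta> * 1" using eta by (intro mult_left_mono) auto
    ultimately show False using eta by simp
  qed
  then obtain u where u: "(\<rho> + \<eta>) * real M ^ 2 < real (card {z \<in> Z. u + E * z \<in> B})"
    unfolding cZ by blast
  have "card {z \<in> Z. u + E * z \<in> B} \<le> card {z \<in> Z. (x0 + D * u) + (D * E) * z \<in> A}"
    using fin by (intro card_mono) (auto simp: B_def algebra_simps)
  then have "(\<rho> + \<eta>) * real M ^ 2 \<le> real (card {z \<in> gbox (real M). (x0 + D * u) + (D * E) * z \<in> A})"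
    using u by (simp add: Z_def)
  moreover have "cmod (D * E) \<le> real (T ^ K)"
  proof -
    have "cmod (D * E) \<le> real T * real (T ^ e)"
      unfolding norm_mult using D(3) E_le by (intro mult_mono) auto
    also have "\<dots> = real (T ^ Suc e)" by simp
    also have "\<dots> \<le> real (T ^ K)"
      unfolding of_nat_le_iff using T by (intro power_increasing) (auto simp: K_def e_def)
    finally show ?thesis .
  qed
  ultimately show ?thesis
    using D E0 E_gauss unfolding \<eta>_def \<sigma>_def
    by (intro exI[of _ "x0 + D * u"] exI[of _ "D * E"]) (auto intro: gauss_int_mult)
qed

section \<open>Iteration of the increment and the double logarithm\<close>

text \<open>The conditions on \<open>T0\<close> are monotone, so they persist as \<open>T\<close>
  grows to \<open>T ^ K\<close>. Keeping \<open>\<delta>\<close> fixed as a lower bound makes every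
  increment the same \<open>\<eta>\<close>, and density cannot exceed 1.\<close>

lemma density_iteration:
  fixes q :: "complex poly" and T0 T L j n :: nat and \<delta> \<rho> :: real
  defines "K \<equiv> 2 + j + j * 2 ^ j + 2 ^ Suc j"
    and "\<eta> \<equiv> (\<delta>\<^sup>2 / 4) ^ (2 ^ Suc j) / 2"
  assumes q: "gauss_poly q" "intersective q" "degree q = Suc j"
    and delta: "0 < \<delta>"
    and T0_delta: "1 \<le> \<delta>\<^sup>2 / 4 * real T0"
    and T0_32: "32 \<le> T0"
    and T0_lead: "fact (Suc j) * cmod (lead_coeff q) \<le> real T0"
    and T0_coeffs: "8 * (\<Sum>i\<le>degree q. cmod (coeff q i)) * real (j + 3) ^ Suc j \<le> \<delta> * real T0"
    and T0_degree: "4 * real (Suc j) \<le> \<delta> * real T0"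
    and A: "\<forall>a\<in>A. \<forall>b\<in>A. a \<noteq> b \<longrightarrow> \<not> (\<exists>z. gauss_int z \<and> a - b = poly q z)"
    and T: "T0 \<le> T" and D: "gauss_int D" "D \<noteq> 0" "cmod D \<le> real T"
    and L: "T ^ (((j + 2) * K) ^ n) \<le> L" and rho: "\<delta> \<le> \<rho>"
    and dens: "\<rho> * real L ^ 2 \<le> real (card {x \<in> gbox (real L). x0 + D * x \<in> A})"
  shows "\<rho> + real n * \<eta> \<le> 1"
  using T D L rho dens
proof (induction n arbitrary: T D L \<rho> x0)
  case (0 T D L \<rho> x0)
  have "card {x \<in> gbox (real L). x0 + D * x \<in> A} \<le> L ^ 2"
    unfolding card_gbox[symmetric] by (intro card_mono finite_gbox) auto
  then have "real (card {x \<in> gbox (real L). x0 + D * x \<in> A}) \<le> real L ^ 2"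
    by (metis of_nat_le_iff of_nat_power)
  then have "\<rho> * real L ^ 2 \<le> 1 * real L ^ 2" using 0(7) by linarith
  moreover have "L > 0" using 0(1,5) T0_32 by simp
  ultimately show ?case by simp
next
  case (Suc n T D L \<rho> x0)
  have T32: "32 \<le> T" using Suc.prems(1) T0_32 by simp
  have TT0: "real T0 \<le> real T" using Suc.prems(1) by simp
  define e where "e = ((j + 2) * K) ^ n"
  have K: "1 \<le> K" by (simp add: K_def)
  have e: "1 \<le> e" unfolding e_def using K by (intro one_le_power) simp
  \<comment> \<open>The next box: it has the size that the induction hypothesis asks for with
    \<open>T ^ K\<close> and \<open>n\<close>, and its power \<open>j + 2\<close> is exactly the
    lower bound assumed for \<open>L\<close>.\<close>
  define M where "M = (T ^ K) ^ e"
  have "(T ^ K) ^ 1 \<le> (T ^ K) ^ e" using e T32 by (intro power_increasing) auto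
  then have M: "T ^ K \<le> M" by (simp add: M_def)
  have "M ^ (j + 2) = T ^ (((j + 2) * K) ^ Suc n)"
    unfolding M_def e_def power_mult[symmetric] by (simp only: power_Suc mult_ac)
  then have M_le_L: "M ^ (j + 2) \<le> L" using Suc.prems(5) by simp
  have TK: "T \<le> T ^ K" using power_increasing[OF K, of T] T32 by simp
  have "M > 0" using M TK T32 by linarith
  then have Lpos: "L > 0" using M_le_L by (metis gr0I le_zero_eq power_eq_0_iff less_irrefl)
  \<comment> \<open>The increment needs the exact density, because \<open>g\<close> has to sum to
    zero.\<close>
  define \<rho>' where "\<rho>' = real (card {x \<in> gbox (real L). x0 + D * x \<in> A}) / real L ^ 2"
  have dens': "real (card {x \<in> gbox (real L). x0 + D * x \<in> A}) = \<rho>' * real L ^ 2"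
    using Lpos by (simp add: \<rho>'_def)
  have rr: "\<rho> \<le> \<rho>'" using Suc.prems(7) Lpos by (simp add: \<rho>'_def field_simps)
  have "card {x \<in> gbox (real L). x0 + D * x \<in> A} \<le> L ^ 2"
    unfolding card_gbox[symmetric] by (intro card_mono finite_gbox) auto
  then have "real (card {x \<in> gbox (real L). x0 + D * x \<in> A}) \<le> real L ^ 2"
    by (metis of_nat_le_iff of_nat_power)
  then have rho1: "\<rho>' \<le> 1" using Lpos by (simp add: \<rho>'_def)
  have "\<delta>\<^sup>2 / 4 * real T0 \<le> \<delta>\<^sup>2 / 4 * real T" "\<delta> * real T0 \<le> \<delta> * real T"
    using TT0 delta by (auto intro: mult_left_mono)
  then have T: "1 \<le> \<delta>\<^sup>2 / 4 * real T" "fact (Suc j) * cmod (lead_coeff q) \<le> real T"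
      "8 * (\<Sum>i\<le>degree q. cmod (coeff q i)) * real (j + 3) ^ Suc j \<le> \<delta> * real T"
      "4 * real (Suc j) \<le> \<delta> * real T"
    using T0_delta T0_lead T0_coeffs T0_degree TT0 by linarith+
  have "\<delta> \<le> \<rho>'" using rr Suc.prems(6) by linarith
  from density_increment[OF q Suc.prems(2-4) delta this rho1 T(1) T32 T(2-4)
      M[unfolded K_def] M_le_L A dens']
  obtain x' D' where D': "gauss_int D'" "D' \<noteq> 0" "cmod D' \<le> real (T ^ K)" and
    x': "(\<rho>' + \<eta>) * real M ^ 2 \<le> real (card {z \<in> gbox (real M). x' + D' * z \<in> A})"
    unfolding K_def \<eta>_def by blast
  have eta: "0 \<le> \<eta>" by (simp add: \<eta>_def)
  have "\<rho>' + \<eta> + real n * \<eta> \<le> 1"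
    using Suc.prems(1,6) TK rr eta by (intro Suc.IH[OF _ D' _ _ x']) (auto simp: M_def e_def)
  then show ?case using rr by (simp add: algebra_simps)
qed

text \<open>The eighth power of \<open>1 - 1/8 \<le> exp (-1/8)\<close> gives
  \<open>exp 1 \<le> (8/7) ^ 8\<close>, which is below 3. Hence \<open>ln (ln N)\<close> is positive
  already from \<open>N = 3\<close> on.\<close>

lemma exp_one_less_3: "exp 1 < (3::real)"
proof -
  have "(7/8)^8 \<le> exp (-(1/8)::real) ^ 8"
    using exp_ge_add_one_self[of "-(1/8)::real"] by (intro power_mono) auto
  also have "\<dots> = exp (-1)" by (simp flip: exp_of_nat_mult)
  finally have "(7/8)^8 * exp 1 \<le> (1::real)" by (simp add: exp_minus field_simps)
  then show ?thesis by (simp add: power_divide field_simps)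
qed

theorem theorem1:
  fixes d :: nat
  assumes "d \<ge> 2"
  shows "\<exists>\<epsilon>::real. \<epsilon> > 0 \<and>
    (\<forall>q::complex poly. gauss_poly q \<and> intersective q \<and> degree q = d \<longrightarrow>
      (\<exists>C::real. \<forall>(N::nat) (A::complex set).
         N \<ge> 3 \<and> A \<subseteq> gbox (real N) \<and> A \<noteq> {} \<and>
         (\<forall>a\<in>A. \<forall>b\<in>A. a \<noteq> b \<longrightarrow> \<not> (\<exists>z. gauss_int z \<and> a - b = poly q z))
         \<longrightarrow> real (card A) / real N ^ 2 \<le> C / (ln (ln (real N))) powr \<epsilon>))"
proof -
  obtain j where j: "d = Suc j" using assms by (cases d) auto
  define P where "P = (2::nat) ^ Suc d"
  define \<epsilon> where "\<epsilon> = 1 / real P"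
  have P: "P \<ge> 2" using assms by (auto simp: P_def Suc_le_eq)
  define E where "E = (j + 2) * (2 + j + j * 2 ^ j + 2 ^ Suc j)"
  have E1: "1 \<le> real E" by (simp add: E_def)
  show ?thesis
  proof (rule exI[of _ \<epsilon>], intro conjI allI impI)
    show "\<epsilon> > 0" using P by (simp add: \<epsilon>_def)
    fix q :: "complex poly"
    assume q: "gauss_poly q \<and> intersective q \<and> degree q = d"
    define b1 where "b1 = fact (Suc j) * cmod (lead_coeff q)"
    define b2 where "b2 = 8 * (\<Sum>i\<le>degree q. cmod (coeff q i)) * real (j + 3) ^ Suc j"
    \<comment> \<open>Collects all thresholds depending on \<open>q\<close>. With \<open>T\<close>
      about \<open>b / \<delta>\<^sup>2\<close>, each of \<open>T\<close>,
      \<open>\<delta> * T\<close> and \<open>\<delta>\<^sup>2 * T\<close> is at least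
      \<open>b\<close>, so every condition of the iteration holds at once.\<close>
    define b where "b = 32 + b1 + b2 + 4 * real (Suc j)"
    have b12: "0 \<le> b1" "0 \<le> b2" by (auto simp: b1_def b2_def intro!: mult_nonneg_nonneg sum_nonneg)
    define C where "C = 4 * 4 ^ (2 ^ d) * ln (real E) + 2 * b"
    show "\<exists>C::real. \<forall>(N::nat) (A::complex set).
         N \<ge> 3 \<and> A \<subseteq> gbox (real N) \<and> A \<noteq> {} \<and>
         (\<forall>a\<in>A. \<forall>b\<in>A. a \<noteq> b \<longrightarrow> \<not> (\<exists>z. gauss_int z \<and> a - b = poly q z))
         \<longrightarrow> real (card A) / real N ^ 2 \<le> C / (ln (ln (real N))) powr \<epsilon>"
    proof (intro exI[of _ "C powr \<epsilon>"] allI impI, elim conjE)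
      fix N :: nat and A :: "complex set"
      assume N: "N \<ge> 3" and A: "A \<subseteq> gbox (real N)" "A \<noteq> {}"
        and avoid: "\<forall>a\<in>A. \<forall>b\<in>A. a \<noteq> b \<longrightarrow> \<not> (\<exists>z. gauss_int z \<and> a - b = poly q z)"
      define \<delta> where "\<delta> = real (card A) / real N ^ 2"
      have "card A \<le> N ^ 2" using card_mono[OF finite_gbox A(1)] by (simp add: card_gbox)
      then have "real (card A) \<le> real N ^ 2" by (metis of_nat_le_iff of_nat_power)
      moreover have "card A > 0" using A finite_subset[OF A(1) finite_gbox] by (simp add: card_gt_0_iff)
      ultimately have delta: "0 < \<delta>" "\<delta> \<le> 1" using N by (auto simp: \<delta>_def)
      have dpow: "0 < \<delta> ^ k" "\<delta> ^ k \<le> 1" for k using delta by (auto simp: power_le_one)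
      define T where "T = nat \<lceil>b / \<delta>\<^sup>2\<rceil>"
      have b32: "32 \<le> b" using b12 by (simp add: b_def)
      have T_ge: "b / \<delta>\<^sup>2 \<le> real T" unfolding T_def by linarith
      have "b / 1 \<le> b / \<delta>\<^sup>2" using b32 dpow[of 2] by (intro divide_left_mono) auto
      then have bT: "b \<le> real T" using T_ge by simp
      have bT2: "b \<le> \<delta>\<^sup>2 * real T" using T_ge dpow(1)[of 2] by (simp add: field_simps)
      have "\<delta>\<^sup>2 * real T \<le> \<delta> * real T"
        using delta by (intro mult_right_mono) (auto simp: power2_eq_square mult_left_le)
      then have bT1: "b \<le> \<delta> * real T" using bT2 by linarith
      have T_le: "real T \<le> 2 * b / \<delta>\<^sup>2"
      proof -
        have "1 \<le> b / \<delta>\<^sup>2" using \<open>b / 1 \<le> b / \<delta>\<^sup>2\<close> b32 by simp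
        then have "real T \<le> b / \<delta>\<^sup>2 + 1" unfolding T_def by linarith
        then show ?thesis using \<open>1 \<le> b / \<delta>\<^sup>2\<close> by simp
      qed
      define \<eta> where "\<eta> = (\<delta>\<^sup>2 / 4) ^ (2 ^ Suc j) / 2"
      have eta: "0 < \<eta>" "\<eta> \<le> 1"
        using delta dpow[of 2] by (auto simp: \<eta>_def intro!: power_le_one order_trans[OF power_le_one])
      \<comment> \<open>One step more than the density can bear: \<open>n * \<eta> > 1\<close>
        contradicts the iteration from \<open>D = 1\<close>, \<open>L = N\<close>, and therefore
        \<open>N < T ^ (E ^ n)\<close>.\<close>
      define n where "n = nat \<lfloor>1 / \<eta>\<rfloor> + 1"
      have "1 / \<eta> < real n" using eta unfolding n_def by linarith
      then have n_gt: "1 < real n * \<eta>" using eta by (simp add: field_simps)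
      have "real n \<le> 1 / \<eta> + 1" using eta unfolding n_def by simp
      moreover have "1 \<le> 1 / \<eta>" using eta by simp
      ultimately have n_le: "real n \<le> 2 / \<eta>" by simp
      have "\<not> T ^ (E ^ n) \<le> N"
      proof
        assume "T ^ (E ^ n) \<le> N"
        have "{x \<in> gbox (real N). 0 + 1 * x \<in> A} = A" using A by auto
        then have "\<delta> * real N ^ 2 \<le> real (card {x \<in> gbox (real N). 0 + 1 * x \<in> A})"
          using N by (simp add: \<delta>_def)
        moreover have "32 \<le> T" using bT b32 by linarith
        moreover have "1 \<le> \<delta>\<^sup>2 / 4 * real T" using bT2 b32 by simp
        moreover have "b1 \<le> real T" "b2 \<le> \<delta> * real T" "4 * real (Suc j) \<le> \<delta> * real T"
          using bT bT1 b12 by (auto simp: b_def)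
        ultimately have "\<delta> + real n * \<eta> \<le> 1"
          unfolding \<eta>_def using q j delta avoid \<open>T ^ (E ^ n) \<le> N\<close> gauss_int_1
          by (intro density_iteration[of q j \<delta> T A T 1 n N \<delta> 0]) (auto simp: b1_def b2_def E_def)
        then show False using n_gt delta by simp
      qed
      then have "real N < real (T ^ (E ^ n))" by (simp only: of_nat_less_iff not_le)
      moreover have T1: "1 < real T" using bT b32 by linarith
      ultimately have "ln (real N) < ln (real T ^ (E ^ n))" using N by simp
      also have "\<dots> = real E ^ n * ln (real T)" using T1 by (simp add: ln_realpow)
      finally have lnN: "ln (real N) < real E ^ n * ln (real T)" .
      have "exp 1 < real N" using exp_one_less_3 N by linarith
      then have "1 < ln (real N)" using N ln_less_cancel_iff[of "exp 1" "real N"] by simp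
      then have lnln: "0 < ln (ln (real N))" by simp
      have "ln (ln (real N)) \<le> ln (real E ^ n * ln (real T))"
        using lnN \<open>1 < ln (real N)\<close> by (intro ln_mono) auto
      also have "\<dots> = real n * ln (real E) + ln (ln (real T))"
        using E1 T1 by (simp add: ln_mult ln_realpow)
      \<comment> \<open>The crude bound of \<open>ln (ln T)\<close> by \<open>T\<close> is harmless:
        it costs only \<open>1 / \<delta>\<^sup>2\<close>, whereas \<open>1 / \<eta>\<close> is
        already of order \<open>1 / \<delta> ^ P\<close> with \<open>P \<ge> 2\<close>.\<close>
      also have "\<dots> \<le> 2 / \<eta> * ln (real E) + 2 * b / \<delta>\<^sup>2"
      proof (rule add_mono)
        show "real n * ln (real E) \<le> 2 / \<eta> * ln (real E)" using n_le E1 by (intro mult_right_mono) auto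
        have "ln (ln (real T)) \<le> ln (real T)" using T1 by (simp add: ln_le_minus_one order_trans[OF ln_le_minus_one])
        also have "\<dots> \<le> real T" using T1 order_trans[OF ln_le_minus_one, of "real T" "real T"] by simp
        finally show "ln (ln (real T)) \<le> 2 * b / \<delta>\<^sup>2" using T_le by linarith
      qed
      finally have bound: "ln (ln (real N)) \<le> 2 / \<eta> * ln (real E) + 2 * b / \<delta>\<^sup>2" .
      have "\<delta> ^ P = 2 * 4 ^ (2 ^ d) * \<eta>"
        by (simp add: \<eta>_def P_def j power_divide power_mult[symmetric])
      then have "\<delta> ^ P * (2 / \<eta> * ln (real E)) = 4 * 4 ^ (2 ^ d) * ln (real E)"
        using eta by simp
      moreover have "\<delta> ^ P * (2 * b / \<delta>\<^sup>2) \<le> 2 * b"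
      proof -
        have "\<delta> ^ P \<le> \<delta>\<^sup>2" using P delta by (intro power_decreasing) auto
        then have "2 * b * \<delta> ^ P \<le> 2 * b * \<delta>\<^sup>2" using b32 by (intro mult_left_mono) auto
        then show ?thesis using delta by (simp add: field_simps)
      qed
      moreover have "\<delta> ^ P * ln (ln (real N)) \<le> \<delta> ^ P * (2 / \<eta> * ln (real E) + 2 * b / \<delta>\<^sup>2)"
        using bound dpow(1)[of P] by (intro mult_left_mono) auto
      ultimately have "\<delta> ^ P * ln (ln (real N)) \<le> C"
        by (simp add: C_def distrib_left)
      then have "(\<delta> ^ P * ln (ln (real N))) powr \<epsilon> \<le> C powr \<epsilon>"
        using lnln dpow(1)[of P] by (intro powr_mono2) (auto simp: \<epsilon>_def)
      moreover have "(\<delta> ^ P) powr \<epsilon> = \<delta>"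
        using delta P by (simp add: \<epsilon>_def powr_powr flip: powr_realpow)
      ultimately have "\<delta> * ln (ln (real N)) powr \<epsilon> \<le> C powr \<epsilon>"
        using delta lnln by (simp add: powr_mult)
      then show "real (card A) / real N ^ 2 \<le> C powr \<epsilon> / ln (ln (real N)) powr \<epsilon>"
        using lnln unfolding \<delta>_def[symmetric] by (simp add: pos_le_divide_eq)
    qed
  qed
qed

end
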